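(* Let $G$ be a finite directed graph with vertex set $\mathcal V$ and adjacency matrix $A_G$, let $\rho$ be the inverse of the Perron eigenvalue of $A_G$, and let $v\in\mathcal V$ be such that $q_v(\rho^2)<\frac34$. Then $$h(X_v)>-\log\rho+\frac{p_v(\rho)}{2\rho^2p'(\rho)}\Big[q_v(\rho^2)-\frac34\Big].$$
   Context: Let $G$ be a finite directed graph with vertex set $\mathcal V$ and edge set $\mathcal E$; $s(e)$ and $r(e)$ are the initial and final vertex of $e\in\mathcal E$; $A_G(u,w)$ is the number of edges from $u$ to $w$. Take two copies $\mathcal E^-=\{e^-:e\in\mathcal E\}$ and $\mathcal E^+=\{e^+:e\in\mathcal E\}$, where $e^-$ goes from $s(e)$ to $r(e)$ and $e^+$ goes from $r(e)$ to $s(e)$. The graph inverse semigroup of $G$ is the semigroup with zero generated by $\mathcal E^-\cup\{P_u:u\in\mathcal V\}\cup\mathcal E^+$ with relations $P_u^2=P_u$, $P_uP_w=0$ for $u\neq w$; $P_{s(e)}e^-=e^-=e^-P_{r(e)}$ and $P_{r(e)}e^+=e^+=e^+P_{s(e)}$; $f^-f^+=P_{s(f)}$ and $f^-g^+=0$ for $f\ne g$; consequently $g^+f^-=0$ if $s(f)\neq s(g)$, $f^-g^-=0$ if $r(f)\ne s(g)$, and $f^+g^+=0$ if $s(f)\neq r(g)$. The Markov-Dyck shift $D_G$ is the subshift over the alphabet $\mathcal E^-\cup\mathcal E^+$ whose admissible words are exactly the words whose product in this semigroup is nonzero. For $v\in\mathcal V$, $X_v$ is the subshift of $D_G$ obtained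 by excluding the words $e^-e^+$ with $e\in\mathcal E$, $r(e)\ne v$, and the words $f^+g^-$ with $f,g\in\mathcal E$, $s(f)\neq v$. The topological entropy of a subshift $X$ is $h(X)=\lim_{n\to\infty}\frac1n\log\#\mathcal L_n(X)$, where $\mathcal L_n(X)$ is the set of admissible words of $X$ of length $n$. $p(z)=\det(I-A_Gz)$; $p_v(z)$ is the determinant of the matrix $I-A_Gz$ with the $v$-th row and $v$-th column deleted; $q_v=p/p_v$; $p'$ is the derivative of $p$. *)

theory Defs
  imports
    "HOL-Analysis.Analysis"
    "HOL-Computational_Algebra.Field_as_Ring"
    "HOL-Computational_Algebra.Normalized_Fraction"
    "HOL-Computational_Algebra.Polynomial_Factorial"
    "Graph_Theory.Digraph"
    "Jordan_Normal_Form.Determinant"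
    "Jordan_Normal_Form.Spectral_Radius"
begin

section \<open>Subshifts\<close>

text \<open>A bi-infinite sequence over the alphabet \<open>'s\<close> is a function \<open>int \<Rightarrow> 's\<close>, and a subshift is
  represented by the set of its points.\<close>

definition block :: "(int \<Rightarrow> 's) \<Rightarrow> int \<Rightarrow> nat \<Rightarrow> 's list" where
  "block x i n = map (\<lambda>k. x (i + int k)) [0..<n]"

definition admissible_words :: "(int \<Rightarrow> 's) set \<Rightarrow> nat \<Rightarrow> 's list set" where
  "admissible_words X n = {block x i n | x i. x \<in> X}"

definition top_entropy :: "(int \<Rightarrow> 's) set \<Rightarrow> real" where
  "top_entropy X = lim (\<lambda>n. ln (real (card (admissible_words X n))) / real n)"


section \<open>The graph inverse semigroup\<close>

text \<open>The semigroup is given by its presentation. Its elements are represented by nonempty words in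
  the generators, two words being identified by the least congruence containing the defining
  relations; the zero is adjoined as a generator together with the relations that make it
  absorbing.\<close>

datatype ('v, 'e) gen = Zero | Vert 'v | Minus 'e | Plus 'e

definition gens :: "('v, 'e) pre_digraph \<Rightarrow> ('v, 'e) gen set" where
  "gens G = insert Zero (Vert ` verts G \<union> Minus ` arcs G \<union> Plus ` arcs G)"

inductive gis_rel :: "('v, 'e) pre_digraph \<Rightarrow> ('v, 'e) gen list \<Rightarrow> ('v, 'e) gen list \<Rightarrow> bool"
  for G where
  zero_left: "a \<in> gens G \<Longrightarrow> gis_rel G [Zero, a] [Zero]"
| zero_right: "a \<in> gens G \<Longrightarrow> gis_rel G [a, Zero] [Zero]"
| vert_idem: "u \<in> verts G \<Longrightarrow> gis_rel G [Vert u, Vert u] [Vert u]"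
| vert_orth: "u \<in> verts G \<Longrightarrow> w \<in> verts G \<Longrightarrow> u \<noteq> w \<Longrightarrow> gis_rel G [Vert u, Vert w] [Zero]"
| minus_source: "e \<in> arcs G \<Longrightarrow> gis_rel G [Vert (tail G e), Minus e] [Minus e]"
| minus_range: "e \<in> arcs G \<Longrightarrow> gis_rel G [Minus e, Vert (head G e)] [Minus e]"
| plus_range: "e \<in> arcs G \<Longrightarrow> gis_rel G [Vert (head G e), Plus e] [Plus e]"
| plus_source: "e \<in> arcs G \<Longrightarrow> gis_rel G [Plus e, Vert (tail G e)] [Plus e]"
| cancel: "f \<in> arcs G \<Longrightarrow> gis_rel G [Minus f, Plus f] [Vert (tail G f)]"
| mismatch: "f \<in> arcs G \<Longrightarrow> g \<in> arcs G \<Longrightarrow> f \<noteq> g \<Longrightarrow> gis_rel G [Minus f, Plus g] [Zero]"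

inductive gis_step :: "('v, 'e) pre_digraph \<Rightarrow> ('v, 'e) gen list \<Rightarrow> ('v, 'e) gen list \<Rightarrow> bool"
  for G where
  "gis_rel G a b \<Longrightarrow> gis_step G (xs @ a @ ys) (xs @ b @ ys)"

definition gis_eq :: "('v, 'e) pre_digraph \<Rightarrow> ('v, 'e) gen list \<Rightarrow> ('v, 'e) gen list \<Rightarrow> bool" where
  "gis_eq G = equivclp (gis_step G)"


section \<open>The Markov-Dyck shift and its subshifts\<close>

definition signed_arcs :: "('v, 'e) pre_digraph \<Rightarrow> ('v, 'e) gen set" where
  "signed_arcs G = Minus ` arcs G \<union> Plus ` arcs G"

text \<open>Every word over the signed arcs with nonzero product can be extended on both sides to a longer
  word with nonzero product, so that the admissible words of the following set of sequences are
  exactly the words with nonzero product.\<close>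

definition markov_dyck :: "('v, 'e) pre_digraph \<Rightarrow> (int \<Rightarrow> ('v, 'e) gen) set" where
  "markov_dyck G = {x. range x \<subseteq> signed_arcs G \<and> (\<forall>i n. \<not> gis_eq G (block x i n) [Zero])}"

definition excluded_words :: "('v, 'e) pre_digraph \<Rightarrow> 'v \<Rightarrow> ('v, 'e) gen list set" where
  "excluded_words G v =
     {[Minus e, Plus e] | e. e \<in> arcs G \<and> head G e \<noteq> v} \<union>
     {[Plus f, Minus g] | f g. f \<in> arcs G \<and> g \<in> arcs G \<and> tail G f \<noteq> v}"

definition vertex_subshift :: "('v, 'e) pre_digraph \<Rightarrow> 'v \<Rightarrow> (int \<Rightarrow> ('v, 'e) gen) set" where
  "vertex_subshift G v =
     {x \<in> markov_dyck G. \<forall>i n. block x i n \<notin> excluded_words G v}"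


section \<open>The adjacency matrix and its determinants\<close>

definition num_arcs :: "('v, 'e) pre_digraph \<Rightarrow> 'v \<Rightarrow> 'v \<Rightarrow> nat" where
  "num_arcs G u w = card {e \<in> arcs G. tail G e = u \<and> head G e = w}"

text \<open>Matrix indices are natural numbers, so the vertices are numbered by the library bijection
  \<open>to_nat_on (verts G)\<close> between the finite set \<open>verts G\<close> and \<open>{..<card (verts G)}\<close>, whose inverse is
  \<open>from_nat_into (verts G)\<close>. Neither the spectrum nor the determinants below depend on the
  numbering. The entries are taken in an arbitrary ring because the matrix is needed both over the
  complex numbers and over the real polynomials.\<close>

definition adjacency_mat :: "('v, 'e) pre_digraph \<Rightarrow> 'a :: comm_ring_1 mat" where
  "adjacency_mat G = mat (card (verts G)) (card (verts G))
     (\<lambda>(i, j). of_nat (num_arcs G (from_nat_into (verts G) i) (from_nat_into (verts G) j)))"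

definition perron_eigenvalue :: "complex mat \<Rightarrow> real \<Rightarrow> bool" where
  "perron_eigenvalue A r \<longleftrightarrow> eigenvalue A (complex_of_real r) \<and> r = spectral_radius A"

text \<open>\<open>I - A\<^sub>G z\<close> as a matrix of polynomials in \<open>z\<close>.\<close>

definition I_minus_Az :: "('v, 'e) pre_digraph \<Rightarrow> real poly mat" where
  "I_minus_Az G = 1\<^sub>m (card (verts G)) - [:0, 1:] \<cdot>\<^sub>m adjacency_mat G"

definition p_poly :: "('v, 'e) pre_digraph \<Rightarrow> real poly" where
  "p_poly G = det (I_minus_Az G)"

definition p_del :: "('v, 'e) pre_digraph \<Rightarrow> 'v \<Rightarrow> real poly" where
  "p_del G v =
     det (mat_delete (I_minus_Az G) (to_nat_on (verts G) v) (to_nat_on (verts G) v))"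

definition q_fract :: "('v, 'e) pre_digraph \<Rightarrow> 'v \<Rightarrow> real poly fract" where
  "q_fract G v = to_fract (p_poly G) / to_fract (p_del G v)"

text \<open>The value of a rational function is computed from its reduced representation, so that removable
  singularities are filled in.\<close>

definition ratfun_eval :: "real poly fract \<Rightarrow> real \<Rightarrow> real" where
  "ratfun_eval q z = (case quot_of_fract q of (a, b) \<Rightarrow> poly a z / poly b z)"

end

theory Submission
  imports Defs "Graph_Theory.Arc_Walk"
begin

text \<open>Let \<open>a\<^sub>n\<close> be the number of loops of length \<open>n\<close> at \<open>v\<close> that return to \<open>v\<close> only at their end, and
  let \<open>F(z)\<close> be the sum of \<open>a\<^sub>n z\<^sup>n\<close>. Every closed walk at \<open>v\<close> is a unique product of such loops, and
  the adjugate of \<open>I - A z\<close> expresses the series counting closed walks as \<open>p\<^sub>v / p\<close>; therefore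
  \<open>q\<^sub>v = 1 - F\<close> on \<open>[0, \<rho>)\<close>, as \<open>first_return_series_inside\<close> shows. In particular \<open>F < 1\<close> there, so
  that the series still converges at \<open>\<rho>\<close>, and the hypothesis reads \<open>F(\<rho>\<^sup>2) > 1/4\<close>.

  The subshift \<open>X\<^sub>v\<close> changes sign only at \<open>v\<close>, and so contains all Dyck words whose bracket pairs are
  these loops: the empty word and the words \<open>c\<^sup>- w1 c\<^sup>+ w2\<close> with a loop \<open>c\<close> and Dyck words \<open>w1\<close>,
  \<open>w2\<close>. As they parse uniquely, their generating function \<open>B\<close> satisfies \<open>1 + F(z\<^sup>2) B(z)\<^sup>2 \<le> B(z)\<close>
  wherever it converges, which forces \<open>F(z\<^sup>2) \<le> 1/4\<close>. It does converge for \<open>z < \<zeta>\<close>, where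
  \<open>\<zeta> = exp (-h(X\<^sub>v))\<close>, since Dyck words are admissible. Thus \<open>F(\<zeta>\<^sup>2) \<le> 1/4 < F(\<rho>\<^sup>2)\<close> and \<open>\<zeta> < \<rho>\<close>;
  this is \<open>entropy_radius\<close>.

  It remains to make \<open>h(X\<^sub>v) + ln \<rho> = ln (\<rho> / \<zeta>) > 0\<close> quantitative. On the one hand it exceeds
  \<open>(\<rho>\<^sup>2 - \<zeta>\<^sup>2) / (2 \<rho>\<^sup>2)\<close>. On the other hand \<open>F\<close> is convex and \<open>\<rho>\<^sup>2 \<le> \<rho>\<close>, so
  \<open>F(\<rho>\<^sup>2) - 1/4 \<le> F(\<rho>\<^sup>2) - F(\<zeta>\<^sup>2) \<le> F'(\<rho>) (\<rho>\<^sup>2 - \<zeta>\<^sup>2)\<close>, and \<open>F'(\<rho>) = - p'(\<rho>) / p\<^sub>v(\<rho>)\<close> because \<open>p\<close>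
  vanishes at \<open>\<rho>\<close>. If \<open>p\<^sub>v(\<rho>)\<close> or \<open>p'(\<rho>)\<close> is zero, as can happen when the graph is
  not strongly connected, then the correction term is zero and \<open>\<zeta> < \<rho>\<close> suffices.\<close>

section \<open>Topological entropy as a limit\<close>

text \<open>Fekete's lemma, for nonnegative sequences: writing \<open>n = q m + k\<close> with \<open>k < m\<close> shows that
  \<open>u n / n\<close> exceeds \<open>u m / m\<close> by at most \<open>M / n\<close>, where \<open>M\<close> bounds the finitely many \<open>u k\<close>;
  hence the quotients tend to their infimum.\<close>

lemma fekete_convergent:
  fixes u :: "nat \<Rightarrow> real"
  assumes subadd: "\<And>m n. u (m + n) \<le> u m + u n" and nonneg: "\<And>n. 0 \<le> u n"
  shows "convergent (\<lambda>n. u n / real n)"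
proof -
  define S where "S = (\<lambda>n. u n / real n) ` {1..}"
  define L where "L = Inf S"
  have bdd: "bdd_below S"
    unfolding S_def by (rule bdd_belowI2[where m = 0]) (use nonneg in auto)
  have mult: "u (q * m) \<le> real q * u m + u 0" for q m
  proof (induction q)
    case (Suc q)
    have "u (Suc q * m) \<le> u m + u (q * m)" using subadd[of m "q * m"] by simp
    with Suc show ?case by (simp add: algebra_simps)
  qed simp
  have "(\<lambda>n. u n / real n) \<longlonglongrightarrow> L"
  proof (rule LIMSEQ_I)
    fix e :: real assume e: "e > 0"
    have "S \<noteq> {}" unfolding S_def by auto
    then obtain s where "s \<in> S" "s < L + e / 2"
      using cInf_lessD[of S "L + e / 2"] e unfolding L_def by auto
    then obtain m where m: "m \<ge> 1" "u m / real m < L + e / 2" unfolding S_def by auto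
    define M where "M = u 0 + (\<Sum>k<m. u k)"
    have M0: "0 \<le> M" unfolding M_def by (intro add_nonneg_nonneg sum_nonneg nonneg)
    obtain N where N: "real N > 2 * M / e" using reals_Archimedean2 by blast
    show "\<exists>no. \<forall>n\<ge>no. norm (u n / real n - L) < e"
    proof (intro exI allI impI)
      fix n assume n: "n \<ge> max 1 N"
      define q k where "q = n div m" and "k = n mod m"
      have n_eq: "n = q * m + k" unfolding q_def k_def by simp
      have k: "k < m" unfolding k_def using m by simp
      have "u k \<le> (\<Sum>k<m. u k)" using k nonneg by (intro member_le_sum) auto
      then have "u n \<le> real q * u m + M"
        using subadd[of "q * m" k] mult[of q m] unfolding n_eq M_def by linarith
      then have "u n / real n \<le> (real q * u m + M) / real n"
        by (intro divide_right_mono) auto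
      also have "\<dots> = real q * real m / real n * (u m / real m) + M / real n"
        using m by (simp add: add_divide_distrib)
      also have "\<dots> \<le> 1 * (u m / real m) + M / real n"
      proof (intro add_right_mono mult_right_mono)
        have "real q * real m \<le> real n" unfolding n_eq by simp
        then show "real q * real m / real n \<le> 1" using n by simp
      qed (use nonneg in simp)
      also have "M / real n < e / 2"
      proof -
        have "2 * M / e < real n" using N n by linarith
        then show ?thesis using e n by (simp add: field_simps)
      qed
      finally have "u n / real n < L + e" using m by simp
      moreover have "L \<le> u n / real n"
        unfolding L_def by (rule cInf_lower[OF _ bdd]) (use n in \<open>auto simp: S_def\<close>)
      ultimately show "norm (u n / real n - L) < e" by simp
    qed
  qed
  then show ?thesis by (rule convergentI)
qed

lemma length_block [simp]: "length (block x i n) = n"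
  by (simp add: block_def)

lemma block_add: "block x i (m + n) = block x i m @ block x (i + int m) n"
  by (rule nth_equalityI) (auto simp: block_def nth_append algebra_simps)

lemma block_Suc: "block x i (Suc n) = x i # block x (i + 1) n"
  using block_add[of x i 1 n] by (simp add: block_def)

locale nonempty_subshift =
  fixes X :: "(int \<Rightarrow> 's) set" and S :: "'s set"
  assumes finite_alphabet: "finite S"
    and range_alphabet: "\<And>x. x \<in> X \<Longrightarrow> range x \<subseteq> S"
    and nonempty: "X \<noteq> {}"
begin

lemma admissible_words_subset: "admissible_words X n \<subseteq> {w. set w \<subseteq> S \<and> length w = n}"
  using range_alphabet by (fastforce simp: admissible_words_def block_def)

lemma finite_admissible_words: "finite (admissible_words X n)"
  by (rule finite_subset[OF admissible_words_subset finite_lists_length_eq[OF finite_alphabet]])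

lemma card_admissible_words_pos: "0 < card (admissible_words X n)"
  using nonempty finite_admissible_words by (auto simp: card_gt_0_iff admissible_words_def)

lemma card_admissible_words_add:
  "card (admissible_words X (m + n)) \<le> card (admissible_words X m) * card (admissible_words X n)"
proof -
  have "admissible_words X (m + n)
      \<subseteq> (\<lambda>(a, b). a @ b) ` (admissible_words X m \<times> admissible_words X n)"
    by (force simp: admissible_words_def block_add)
  then have "card (admissible_words X (m + n))
      \<le> card ((\<lambda>(a, b). a @ b) ` (admissible_words X m \<times> admissible_words X n))"
    by (intro card_mono finite_imageI finite_cartesian_product finite_admissible_words)
  also have "\<dots> \<le> card (admissible_words X m \<times> admissible_words X n)"
    by (intro card_image_le finite_cartesian_product finite_admissible_words)
  finally show ?thesis by (simp add: card_cartesian_product)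
qed

lemma top_entropy_limit:
  "(\<lambda>n. ln (real (card (admissible_words X n))) / real n) \<longlonglongrightarrow> top_entropy X"
proof -
  have "convergent (\<lambda>n. ln (real (card (admissible_words X n))) / real n)"
  proof (rule fekete_convergent)
    fix m n
    have "ln (real (card (admissible_words X (m + n))))
        \<le> ln (real (card (admissible_words X m)) * real (card (admissible_words X n)))"
      using card_admissible_words_add[of m n] card_admissible_words_pos
      by (subst ln_le_cancel_iff) (auto simp flip: of_nat_mult)
    then show "ln (real (card (admissible_words X (m + n))))
        \<le> ln (real (card (admissible_words X m))) + ln (real (card (admissible_words X n)))"
      using card_admissible_words_pos by (simp add: ln_mult)
  next
    fix n show "0 \<le> ln (real (card (admissible_words X n)))"
      using card_admissible_words_pos[of n] by (intro ln_ge_zero) auto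
  qed
  then show ?thesis unfolding top_entropy_def by (rule convergent_LIMSEQ_iff[THEN iffD1])
qed

text \<open>The radius of convergence of the series counting admissible words is at least
  \<open>exp (-h)\<close>: for \<open>z < exp (-h)\<close> pick \<open>c\<close> with \<open>h < c < - ln z\<close>; eventually there are at most
  \<open>exp (c n)\<close> words of length \<open>n\<close>, and the series is dominated by a geometric one.\<close>

lemma summable_admissible_words:
  assumes z: "0 < z" "z < exp (- top_entropy X)"
  shows "summable (\<lambda>n. real (card (admissible_words X n)) * z ^ n)"
proof -
  have "top_entropy X < - ln z"
    using ln_less_cancel_iff[of z "exp (- top_entropy X)"] z by simp
  then obtain c where c: "top_entropy X < c" "c < - ln z" using dense by blast
  have ev: "\<forall>\<^sub>F n in sequentially. norm (real (card (admissible_words X n)) * z ^ n) \<le> (exp c * z) ^ n"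
    using order_tendstoD(2)[OF top_entropy_limit c(1)] eventually_gt_at_top[of 0]
  proof eventually_elim
    case (elim n)
    then have "ln (real (card (admissible_words X n))) < c * real n"
      by (simp add: field_simps)
    then have "exp (ln (real (card (admissible_words X n)))) \<le> exp (c * real n)"
      by simp
    then have "real (card (admissible_words X n)) \<le> exp c ^ n"
      using card_admissible_words_pos[of n] by (simp add: exp_of_nat2_mult)
    then show ?case using z by (simp add: power_mult_distrib mult_right_mono)
  qed
  have "exp c * z < exp (- ln z) * z" using c z by simp
  then have "norm (exp c * z) < 1" using z by (simp add: exp_minus)
  then show ?thesis
    using ev by (intro summable_comparison_test_ev[OF ev] summable_geometric)
qed

end

section \<open>The stack machine of a graph inverse semigroup\<close>

text \<open>The machine moves along the graph and keeps a stack of arcs: a negative arc is traversed and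
  pushed; a positive arc must be on top of the stack and is popped and traversed backwards. Every
  generator thus acts as a partial map on the states, and the zero as the nowhere defined one. The
  defining relations hold for these maps, so a word on which some run succeeds is not zero.\<close>

fun stack_step :: "('v, 'e) pre_digraph \<Rightarrow> ('v, 'e) gen \<Rightarrow> 'v \<times> 'e list \<Rightarrow> ('v \<times> 'e list) option" where
  "stack_step G Zero s = None"
| "stack_step G (Vert u) (x, es) = (if x = u then Some (x, es) else None)"
| "stack_step G (Minus e) (x, es) = (if x = tail G e then Some (head G e, e # es) else None)"
| "stack_step G (Plus e) (x, []) = None"
| "stack_step G (Plus e) (x, f # es) = (if f = e \<and> x = head G e then Some (tail G e, es) else None)"

fun stack_run :: "('v, 'e) pre_digraph \<Rightarrow> ('v, 'e) gen list \<Rightarrow> 'v \<times> 'e list \<Rightarrow> ('v \<times> 'e list) option" where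
  "stack_run G [] s = Some s"
| "stack_run G (a # w) s = Option.bind (stack_step G a s) (stack_run G w)"

lemma stack_run_append: "stack_run G (u @ w) s = Option.bind (stack_run G u s) (stack_run G w)"
  by (induction u arbitrary: s) (auto split: Option.bind_split)

lemma gis_rel_stack_run: "gis_rel G a b \<Longrightarrow> stack_run G a s = stack_run G b s"
proof (induction rule: gis_rel.induct)
  case (zero_right a)
  then show ?case by (cases "stack_step G a s") auto
next
  case (cancel f)
  then show ?case by (cases s) auto
next
  case (mismatch f g)
  then show ?case by (cases s) auto
next
  case (plus_range e)
  then show ?case by (cases s; cases "snd s") auto
next
  case (plus_source e)
  then show ?case by (cases s; cases "snd s") auto
qed (cases s; auto)+

lemma gis_eq_stack_run:
  assumes "gis_eq G a b"
  shows "stack_run G a = stack_run G b"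
proof -
  have step: "stack_run G y = stack_run G z" if "gis_step G y z" for y z
    using that
  proof cases
    case (1 a b xs ys)
    have "stack_run G (a @ ys) = stack_run G (b @ ys)"
      using gis_rel_stack_run[OF 1(3)] by (intro ext) (simp add: stack_run_append)
    then show ?thesis using 1 by (intro ext) (simp add: stack_run_append)
  qed
  show ?thesis using assms unfolding gis_eq_def
    by (induction rule: equivclp_induct) (use step in metis)+
qed

corollary not_zero_if_stack_run: "stack_run G w s \<noteq> None \<Longrightarrow> \<not> gis_eq G w [Zero]"
  using gis_eq_stack_run[of G w "[Zero]"] by auto

section \<open>Dyck words over the first-return loops\<close>

lemma minus_prefix_unique:
  assumes "map Minus c @ w = map Minus d @ u"
  obtains us where "c = d @ us \<or> d = c @ us"
  using assms
proof (induction c arbitrary: d thesis)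
  case Nil
  then show ?case by auto
next
  case (Cons a c)
  show ?case
  proof (cases d)
    case Nil
    then show ?thesis using Cons.prems(1)[of "a # c"] by simp
  next
    case (Cons b d')
    then have "map Minus c @ w = map Minus d' @ u" "a = b" using Cons.prems(2) by auto
    then show ?thesis using Cons.IH[of d'] Cons.prems(1) local.Cons by (metis append_Cons)
  qed
qed

locale pointed_fin_digraph = fin_digraph G for G :: "('v, 'e) pre_digraph" +
  fixes v :: 'v
  assumes v_in_verts: "v \<in> verts G"
begin

definition first_return_loop :: "'e list \<Rightarrow> bool" where
  "first_return_loop c \<longleftrightarrow> awalk v c v \<and> c \<noteq> [] \<and> (\<forall>e\<in>set (butlast c). head G e \<noteq> v)"

definition first_returns :: "nat \<Rightarrow> nat" where
  "first_returns n = card {c. first_return_loop c \<and> length c = n}"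

lemma awalk_subset_arcs: "awalk x p y \<Longrightarrow> set p \<subseteq> arcs G"
  by (auto simp: awalk_def)

lemma awalk_head_last: "awalk x p y \<Longrightarrow> p \<noteq> [] \<Longrightarrow> head G (last p) = y"
  by (induction p arbitrary: x) (auto simp: awalk_simps split: if_splits)

lemma awalk_tail_hd: "awalk x p y \<Longrightarrow> p \<noteq> [] \<Longrightarrow> tail G (hd p) = x"
  by (cases p) (auto simp: awalk_simps)

lemma finite_awalks_length: "finite {p. awalk x p y \<and> length p = n}"
  by (rule finite_subset[OF _ finite_lists_length_eq[OF finite_arcs, of n]])
    (auto dest: awalk_subset_arcs)

lemma finite_first_return_loops: "finite {c. first_return_loop c \<and> length c = n}"
  by (rule finite_subset[OF _ finite_awalks_length[of v v n]]) (auto simp: first_return_loop_def)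

text \<open>A loop that is a proper prefix of another one ends in the interior of the latter, so the
  first-return loops form a prefix code.\<close>

lemma first_return_loop_prefix_free:
  assumes "first_return_loop c" "first_return_loop d" "c @ p = d @ q"
  shows "c = d"
proof -
  have no_extension: "us = []" if loops: "first_return_loop a" "first_return_loop (a @ us)" for a us
  proof (rule ccontr)
    assume "us \<noteq> []"
    then have "last a \<in> set (butlast (a @ us))"
      using loops(1) by (simp add: butlast_append first_return_loop_def)
    moreover have "head G (last a) = v"
      using loops(1) awalk_head_last unfolding first_return_loop_def by blast
    ultimately show False using loops(2) unfolding first_return_loop_def by blast
  qed
  obtain us where "c = d @ us \<or> d = c @ us"
    using assms(3) by (auto simp: append_eq_append_conv2)
  then show ?thesis using no_extension assms(1,2) by auto
qed

text \<open>The Dyck language whose bracket pairs are the first-return loops. A word of the form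
  \<open>c\<^sup>- w1 c\<^sup>+ w2\<close> changes sign only at \<open>v\<close>, which is what membership in \<open>X\<^sub>v\<close> asks for.\<close>

inductive dyck_word :: "('v, 'e) gen list \<Rightarrow> bool" where
  Nil: "dyck_word []"
| Loop: "first_return_loop c \<Longrightarrow> dyck_word w1 \<Longrightarrow> dyck_word w2 \<Longrightarrow>
    dyck_word (map Minus c @ w1 @ map Plus (rev c) @ w2)"

lemma dyck_word_alphabet: "dyck_word w \<Longrightarrow> set w \<subseteq> signed_arcs G"
  by (induction rule: dyck_word.induct)
    (auto simp: signed_arcs_def first_return_loop_def awalk_def)

lemma stack_run_push: "awalk x p y \<Longrightarrow> stack_run G (map Minus p) (x, es) = Some (y, rev p @ es)"
  by (induction p arbitrary: x es) (auto simp: awalk_simps)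

lemma stack_run_pop: "awalk x p y \<Longrightarrow> stack_run G (map Plus (rev p)) (y, rev p @ es) = Some (x, es)"
  by (induction p arbitrary: x es) (auto simp: awalk_simps stack_run_append)

lemma stack_run_dyck_word: "dyck_word w \<Longrightarrow> stack_run G w (v, es) = Some (v, es)"
  by (induction arbitrary: es rule: dyck_word.induct)
    (auto simp: stack_run_append stack_run_push stack_run_pop first_return_loop_def)

text \<open>A nonempty Dyck word leaves \<open>v\<close> with its first letter and comes back to \<open>v\<close> with its last one,
  so a change of sign just before or after it happens at \<open>v\<close>.\<close>

lemma dyck_word_hd_last:
  "dyck_word w \<Longrightarrow> w \<noteq> [] \<Longrightarrow> \<exists>e f. hd w = Minus e \<and> tail G e = v \<and> last w = Plus f \<and> tail G f = v"
proof (induction rule: dyck_word.induct)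
  case (Loop c w1 w2)
  have c: "awalk v c v" "c \<noteq> []" using Loop.hyps(1) by (auto simp: first_return_loop_def)
  then have "tail G (hd c) = v" by (rule awalk_tail_hd)
  with Loop.IH(2) c show ?case by (auto simp: hd_map last_map last_rev hd_append last_append)
qed simp

lemma dyck_word_not_excluded:
  "dyck_word w \<Longrightarrow> successively (\<lambda>a b. [a, b] \<notin> excluded_words G v) w"
proof (induction rule: dyck_word.induct)
  case (Loop c w1 w2)
  have c: "awalk v c v" "c \<noteq> []" using Loop.hyps(1) by (auto simp: first_return_loop_def)
  then have "tail G (hd c) = v" "head G (last c) = v"
    using awalk_tail_hd awalk_head_last by blast+
  moreover have "successively (\<lambda>a b. [a, b] \<notin> excluded_words G v) (map Minus p)"
    "successively (\<lambda>a b. [a, b] \<notin> excluded_words G v) (map Plus p)" for p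
    by (auto simp: successively_conv_nth excluded_words_def)
  moreover have "[Minus (last c), Plus e] \<notin> excluded_words G v"
    "[Plus (hd c), Minus e] \<notin> excluded_words G v" "[Plus e, Plus f] \<notin> excluded_words G v"
    "[Minus e, Minus f] \<notin> excluded_words G v" for e f
    using \<open>tail G (hd c) = v\<close> \<open>head G (last c) = v\<close> by (auto simp: excluded_words_def)
  ultimately show ?case
    using Loop.IH c dyck_word_hd_last[OF Loop.hyps(2)] dyck_word_hd_last[OF Loop.hyps(3)]
    by (auto simp: successively_append_iff hd_append last_append hd_map last_map hd_rev last_rev
        simp del: rev_map)
qed simp

text \<open>A nonempty Dyck word \<open>w\<close> returns the stack machine to the state \<open>(v, [])\<close> in which it
  started. The machine therefore runs forever along the periodic sequence \<open>w w w \<dots>\<close>, which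
  shows that all blocks of this sequence are nonzero.\<close>

lemma dyck_word_periodic_point:
  assumes w: "dyck_word w" "w \<noteq> []"
  defines "x \<equiv> (\<lambda>i. w ! nat (i mod int (length w)))"
  shows "x \<in> vertex_subshift G v" and "block x 0 (length w) = w"
proof -
  define L where "L = length w"
  have L: "L > 0" using w(2) unfolding L_def by simp
  define j where "j i = nat (i mod int L)" for i
  have j_less: "j i < L" for i unfolding j_def using L by (simp add: nat_less_iff)
  have j_Suc: "j (i + 1) = (if Suc (j i) = L then 0 else Suc (j i))" for i
  proof -
    have "(i + 1) mod int L = int (Suc (j i)) mod int L"
      unfolding j_def using L by (simp add: mod_simps add.commute)
    then have "j (i + 1) = Suc (j i) mod L"
      unfolding j_def[of "i + 1"] by (simp only: zmod_int[symmetric] nat_int)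
    then show ?thesis using j_less[of i] by simp
  qed
  have x_eq: "x i = w ! j i" for i unfolding x_def j_def L_def ..
  have L_def': "length w = L" unfolding L_def ..
  \<comment> \<open>the state of the machine before it reads \<open>x i\<close>\<close>
  define \<sigma> where "\<sigma> i = the (stack_run G (take (j i) w) (v, []))" for i
  have defined: "stack_run G (take k w) (v, []) \<noteq> None" for k
    using stack_run_dyck_word[OF w(1), of "[]"] stack_run_append[of G "take k w" "drop k w" "(v, [])"]
    by (cases "stack_run G (take k w) (v, [])") auto
  have \<sigma>: "stack_run G (take (j i) w) (v, []) = Some (\<sigma> i)" for i
    using defined[of "j i"] unfolding \<sigma>_def by auto
  have step: "stack_step G (x i) (\<sigma> i) = Some (\<sigma> (i + 1))" for i
  proof -
    have "stack_run G (take (Suc (j i)) w) (v, []) = stack_step G (x i) (\<sigma> i)"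
      using j_less[of i] \<sigma>[of i]
      by (cases "stack_step G (x i) (\<sigma> i)")
        (simp_all add: take_Suc_conv_app_nth L_def' stack_run_append x_eq)
    moreover have "stack_run G (take (Suc (j i)) w) (v, []) = Some (\<sigma> (i + 1))"
    proof (cases "Suc (j i) = L")
      case True
      then have "\<sigma> (i + 1) = (v, [])" by (simp add: \<sigma>_def j_Suc)
      then show ?thesis using True stack_run_dyck_word[OF w(1), of "[]"] by (simp add: L_def)
    next
      case False
      then show ?thesis using \<sigma>[of "i + 1"] by (simp add: j_Suc)
    qed
    ultimately show ?thesis by simp
  qed
  have run: "stack_run G (block x i n) (\<sigma> i) = Some (\<sigma> (i + int n))" for i n
    by (induction n arbitrary: i) (simp add: block_def, simp add: block_Suc step add.commute add.left_commute)
  have range: "range x \<subseteq> signed_arcs G"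
    using dyck_word_alphabet[OF w(1)] j_less by (auto simp: x_eq L_def)
  have pairs: "[x i, x (i + 1)] \<notin> excluded_words G v" for i
  proof (cases "Suc (j i) = L")
    case True
    then have "x i = last w" "x (i + 1) = hd w"
      using w(2) True[symmetric] by (simp_all add: x_eq j_Suc last_conv_nth hd_conv_nth L_def')
    then show ?thesis using dyck_word_hd_last[OF w] by (auto simp: excluded_words_def)
  next
    case False
    then have "Suc (j i) < length w" using j_less[of i] unfolding L_def by linarith
    then show ?thesis
      using dyck_word_not_excluded[OF w(1)] False by (simp add: successively_conv_nth x_eq j_Suc)
  qed
  have "block x i n \<notin> excluded_words G v" for i n
  proof
    assume excl: "block x i n \<in> excluded_words G v"
    then have "length (block x i n) = 2" by (auto simp: excluded_words_def simp del: length_block)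
    then have "n = 2" by simp
    then have "block x i n = [x i, x (i + 1)]" by (simp add: block_def upt_rec)
    with excl pairs show False by simp
  qed
  moreover have "\<not> gis_eq G (block x i n) [Zero]" for i n
    by (rule not_zero_if_stack_run[of G _ "\<sigma> i"]) (simp add: run)
  ultimately show "x \<in> vertex_subshift G v"
    using range by (auto simp: vertex_subshift_def markov_dyck_def)
  show "block x 0 (length w) = w"
    by (rule nth_equalityI) (auto simp: block_def x_def nat_mod_as_int[symmetric] zmod_int[symmetric])
qed

text \<open>The next lemmas show that Dyck words parse uniquely. The outer loop is determined because the
  loops form a prefix code; the inner word is determined because the letter after it pops an arc
  that this word did not push.\<close>

lemma dyck_word_no_pop_prefix:
  assumes "dyck_word w" "dyck_word (w @ u)" "u \<noteq> []"
  shows "\<nexists>e. hd u = Plus e"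
proof
  assume "\<exists>e. hd u = Plus e"
  then obtain e u' where u: "u = Plus e # u'" using assms(3) by (cases u) auto
  have "stack_run G (w @ u) (v, []) = None"
    by (simp add: u stack_run_append stack_run_dyck_word[OF assms(1)])
  then show False using stack_run_dyck_word[OF assms(2), of "[]"] by simp
qed

lemma dyck_word_split_unique:
  assumes "dyck_word w1" "dyck_word u1" "w1 @ Plus e # w2 = u1 @ Plus f # u2"
  shows "w1 = u1"
proof -
  obtain us where "w1 = u1 @ us \<and> us @ Plus e # w2 = Plus f # u2
      \<or> u1 = w1 @ us \<and> us @ Plus f # u2 = Plus e # w2"
    using assms(3) unfolding append_eq_append_conv2 by metis
  then show ?thesis
    using assms(1,2) dyck_word_no_pop_prefix[of u1 us] dyck_word_no_pop_prefix[of w1 us]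
    by (cases us) auto
qed

lemma dyck_word_decomposition_unique:
  assumes loops: "first_return_loop c" "first_return_loop d"
    and words: "dyck_word w1" "dyck_word u1"
    and eq: "map Minus c @ w1 @ map Plus (rev c) @ w2 = map Minus d @ u1 @ map Plus (rev d) @ u2"
  shows "c = d \<and> w1 = u1 \<and> w2 = u2"
proof -
  obtain us where "c = d @ us \<or> d = c @ us" by (rule minus_prefix_unique[OF eq])
  then have cd: "c = d"
    using first_return_loop_prefix_free[OF loops, of us "[]"]
      first_return_loop_prefix_free[OF loops, of "[]" us] by auto
  obtain e c' where "rev c = e # c'" using loops(1) by (cases "rev c") (auto simp: first_return_loop_def)
  then have "w1 = u1"
    using eq words dyck_word_split_unique[of w1 u1 e "map Plus c' @ w2" e "map Plus c' @ u2"]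
    by (auto simp: cd)
  then show ?thesis using eq cd by simp
qed

lemma dyck_word_admissible:
  assumes "vertex_subshift G v \<noteq> {}" "dyck_word w"
  shows "w \<in> admissible_words (vertex_subshift G v) (length w)"
proof (cases "w = []")
  case True
  then show ?thesis using assms(1) by (auto simp: admissible_words_def block_def)
next
  case False
  then show ?thesis using dyck_word_periodic_point[OF assms(2)]
    unfolding admissible_words_def by (metis (mono_tags, lifting) mem_Collect_eq)
qed

lemma dyck_word_of_loop: "first_return_loop c \<Longrightarrow> dyck_word (map Minus c @ map Plus (rev c))"
  using dyck_word.Loop[of c "[]" "[]"] dyck_word.Nil by simp

lemma nonempty_subshift_if_loop:
  assumes "first_return_loop c"
  shows "nonempty_subshift (vertex_subshift G v) (signed_arcs G)"
proof
  show "finite (signed_arcs G)" by (simp add: signed_arcs_def)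
  show "range x \<subseteq> signed_arcs G" if "x \<in> vertex_subshift G v" for x
    using that by (auto simp: vertex_subshift_def markov_dyck_def)
  have "c \<noteq> []" using assms by (simp add: first_return_loop_def)
  then show "vertex_subshift G v \<noteq> {}"
    using dyck_word_periodic_point(1)[OF dyck_word_of_loop[OF assms]] by auto
qed

lemma finite_dyck_words: "finite {w. dyck_word w \<and> length w \<le> N}"
proof (rule finite_subset)
  show "{w. dyck_word w \<and> length w \<le> N} \<subseteq> {w. set w \<subseteq> signed_arcs G \<and> length w \<le> N}"
    using dyck_word_alphabet by auto
  show "finite {w. set w \<subseteq> signed_arcs G \<and> length w \<le> N}"
    by (rule finite_lists_length_le) (simp add: signed_arcs_def)
qed

lemma finite_first_return_loops_le: "finite {c. first_return_loop c \<and> length c \<le> n}"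
  by (rule finite_subset[OF _ finite_lists_length_le[OF finite_arcs, of n]])
    (auto simp: first_return_loop_def dest: awalk_subset_arcs)

text \<open>The generating function \<open>B\<close> of the Dyck words satisfies \<open>1 + F(z\<^sup>2) B(z)\<^sup>2 \<le> B(z)\<close>
  where \<open>F\<close> counts the first-return loops, because gluing \<open>(c, w1, w2)\<close> to \<open>c\<^sup>- w1 c\<^sup>+ w2\<close> is
  injective and never gives the empty word. The following is this inequality for partial sums.\<close>

lemma dyck_sum_quadratic:
  fixes z :: real
  assumes z: "0 < z"
  defines "S \<equiv> \<lambda>N. \<Sum>w | dyck_word w \<and> length w \<le> N. z ^ length w"
  shows "1 + (\<Sum>i\<le>n. real (first_returns i) * (z\<^sup>2) ^ i) * (S N)\<^sup>2 \<le> S (2 * n + 2 * N)"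
proof -
  define D where "D N = {w. dyck_word w \<and> length w \<le> N}" for N
  define K where "K = {c. first_return_loop c \<and> length c \<le> n}"
  define glue where
    "glue = (\<lambda>(c :: 'e list, w1, w2). map Minus c @ w1 @ map Plus (rev c) @ (w2 :: ('v, 'e) gen list))"
  have fin: "finite K" "finite (D M)" for M
    unfolding K_def D_def by (rule finite_first_return_loops_le finite_dyck_words)+
  have S_D: "S M = (\<Sum>w\<in>D M. z ^ length w)" for M unfolding S_def D_def ..
  have "(\<Sum>i\<le>n. real (first_returns i) * (z\<^sup>2) ^ i)
      = (\<Sum>i\<le>n. \<Sum>c\<in>{c \<in> K. length c = i}. (z\<^sup>2) ^ length c)"
  proof (rule sum.cong)
    fix i assume "i \<in> {..n}"
    then have "{c \<in> K. length c = i} = {c. first_return_loop c \<and> length c = i}"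
      unfolding K_def by auto
    then show "real (first_returns i) * (z\<^sup>2) ^ i
        = (\<Sum>c\<in>{c \<in> K. length c = i}. (z\<^sup>2) ^ length c)"
      by (simp add: first_returns_def)
  qed simp
  also have "\<dots> = (\<Sum>c\<in>K. (z\<^sup>2) ^ length c)"
    by (rule sum.group) (use fin in \<open>auto simp: K_def\<close>)
  finally have F: "(\<Sum>i\<le>n. real (first_returns i) * (z\<^sup>2) ^ i) = (\<Sum>c\<in>K. (z\<^sup>2) ^ length c)" .
  have "(\<Sum>c\<in>K. (z\<^sup>2) ^ length c) * (S N)\<^sup>2
      = (\<Sum>c\<in>K. \<Sum>w1\<in>D N. \<Sum>w2\<in>D N. (z\<^sup>2) ^ length c * (z ^ length w1 * z ^ length w2))"
    unfolding S_D power2_eq_square[of "sum _ _"] by (simp only: sum_product) (simp only: sum_distrib_left)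
  also have "\<dots> = (\<Sum>(c, w1, w2)\<in>K \<times> D N \<times> D N. (z\<^sup>2) ^ length c * (z ^ length w1 * z ^ length w2))"
    by (simp only: sum.cartesian_product)
  also have "\<dots> = (\<Sum>t\<in>K \<times> D N \<times> D N. z ^ length (glue t))"
    by (intro sum.cong refl)
      (auto simp: glue_def power_add power2_eq_square power_mult_distrib mult_ac)
  also have "\<dots> = (\<Sum>w\<in>glue ` (K \<times> D N \<times> D N). z ^ length w)"
  proof (rule sum.reindex_cong[symmetric])
    show "inj_on glue (K \<times> D N \<times> D N)"
    proof (rule inj_onI)
      fix s t assume st: "s \<in> K \<times> D N \<times> D N" "t \<in> K \<times> D N \<times> D N" "glue s = glue t"
      obtain c w1 w2 d u1 u2 where "s = (c, w1, w2)" "t = (d, u1, u2)" by (cases s, cases t)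
      with st dyck_word_decomposition_unique[of c d w1 u1 w2 u2] show "s = t"
        by (simp add: glue_def K_def D_def)
    qed
  qed auto
  finally have "1 + (\<Sum>c\<in>K. (z\<^sup>2) ^ length c) * (S N)\<^sup>2
      = (\<Sum>w\<in>insert [] (glue ` (K \<times> D N \<times> D N)). z ^ length w)"
    using fin by (subst sum.insert) (auto simp: glue_def K_def first_return_loop_def)
  also have "\<dots> \<le> S (2 * n + 2 * N)"
    unfolding S_D
  proof (rule sum_mono2)
    show "insert [] (glue ` (K \<times> D N \<times> D N)) \<subseteq> D (2 * n + 2 * N)"
      by (auto simp: glue_def K_def D_def intro: dyck_word.intros)
  qed (use fin z in auto)
  finally show ?thesis unfolding F .
qed

text \<open>Dyck words are admissible words, so \<open>B(z)\<close> converges for \<open>z < exp (-h)\<close>. There the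
  quadratic inequality \<open>1 + F B\<^sup>2 \<le> B\<close> has a real solution, which forces \<open>4 F \<le> 1\<close>.\<close>

lemma first_returns_partial_sum_le:
  assumes loop: "first_return_loop c"
    and z: "0 < z" "z < exp (- top_entropy (vertex_subshift G v))"
  shows "(\<Sum>i\<le>n. real (first_returns i) * (z\<^sup>2) ^ i) \<le> 1 / 4"
proof -
  let ?X = "vertex_subshift G v"
  interpret nonempty_subshift ?X "signed_arcs G" by (rule nonempty_subshift_if_loop[OF loop])
  define S where "S N = (\<Sum>w | dyck_word w \<and> length w \<le> N. z ^ length w)" for N
  define F where "F = (\<Sum>i\<le>n. real (first_returns i) * (z\<^sup>2) ^ i)"
  define T where "T = (\<Sum>n. real (card (admissible_words ?X n)) * z ^ n)"
  have S_le: "S N \<le> T" for N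
  proof -
    have "S N = (\<Sum>l\<le>N. \<Sum>w\<in>{w \<in> {w. dyck_word w \<and> length w \<le> N}. length w = l}. z ^ length w)"
      unfolding S_def by (rule sum.group[symmetric]) (auto intro: finite_dyck_words)
    also have "\<dots> \<le> (\<Sum>l\<le>N. real (card (admissible_words ?X l)) * z ^ l)"
    proof (rule sum_mono)
      fix l
      have "card {w \<in> {w. dyck_word w \<and> length w \<le> N}. length w = l} \<le> card (admissible_words ?X l)"
        using dyck_word_admissible[OF nonempty] by (intro card_mono finite_admissible_words) auto
      then show "(\<Sum>w\<in>{w \<in> {w. dyck_word w \<and> length w \<le> N}. length w = l}. z ^ length w)
          \<le> real (card (admissible_words ?X l)) * z ^ l"
        using z by (simp add: mult_right_mono)
    qed
    also have "\<dots> \<le> T"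
      unfolding T_def by (rule sum_le_suminf[OF summable_admissible_words]) (use z in auto)
    finally show ?thesis .
  qed
  have "incseq S"
    unfolding S_def incseq_def using z by (auto intro!: sum_mono2 finite_dyck_words)
  then obtain B where B: "S \<longlonglongrightarrow> B" "\<And>N. S N \<le> B"
    using incseq_convergent S_le by metis
  have "1 + F * (S N)\<^sup>2 \<le> B" for N
    using dyck_sum_quadratic[OF z(1), of n N] B(2)[of "2 * n + 2 * N"] unfolding S_def F_def by linarith
  moreover have "(\<lambda>N. 1 + F * (S N)\<^sup>2) \<longlonglongrightarrow> 1 + F * B\<^sup>2" by (intro tendsto_intros B)
  ultimately have quadratic: "1 + F * B\<^sup>2 \<le> B" by (intro LIMSEQ_le_const2[of _ _ B]) auto
  have "0 \<le> F" unfolding F_def using z by (intro sum_nonneg) auto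
  then have "1 \<le> B" using quadratic by (smt (verit) mult_nonneg_nonneg zero_le_power2)
  \<comment> \<open>\<open>4 F B\<^sup>2 \<le> 4 B - 4 = B\<^sup>2 - (B - 2)\<^sup>2\<close>\<close>
  moreover have "4 * F * B\<^sup>2 \<le> B\<^sup>2"
    using quadratic zero_le_power2[of "B - 2"] by (simp add: power2_diff)
  ultimately have "4 * F \<le> 1" by (simp add: mult_le_cancel_right1)
  then show ?thesis unfolding F_def by simp
qed

end

section \<open>Closed walks, first returns and the determinants\<close>

lemma pow_mat_Suc_left:
  assumes A: "(A :: 'a :: semiring_1 mat) \<in> carrier_mat n n"
  shows "A ^\<^sub>m Suc k = A * A ^\<^sub>m k"
proof (induction k)
  case (Suc k)
  then show ?case
    using assoc_mult_mat[OF A pow_carrier_mat[OF A, of k] A] by (metis pow_mat.simps(2))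
qed (use A in simp)

lemma smult_pow_mat:
  assumes A: "(A :: 'a :: comm_semiring_1 mat) \<in> carrier_mat n n"
  shows "(t \<cdot>\<^sub>m A) ^\<^sub>m k = t ^ k \<cdot>\<^sub>m A ^\<^sub>m k"
proof (induction k)
  case 0
  then show ?case using A by (intro eq_matI) auto
next
  case (Suc k)
  then show ?case
    using A pow_carrier_mat[OF A, of k]
    by (intro eq_matI) (auto simp: scalar_prod_def sum_distrib_left mult_ac)
qed

context pointed_fin_digraph
begin

definition walks_to_v :: "'v \<Rightarrow> nat \<Rightarrow> nat" where
  "walks_to_v x n = card {p. awalk x p v \<and> length p = n}"

lemma walks_to_v_0: "x \<in> verts G \<Longrightarrow> walks_to_v x 0 = (if x = v then 1 else 0)"
proof -
  assume "x \<in> verts G"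
  then have "{p. awalk x p v \<and> length p = 0} = (if x = v then {[]} else {})"
    by (auto simp: awalk_simps)
  then show ?thesis by (simp add: walks_to_v_def)
qed

lemma walks_to_v_Suc:
  "walks_to_v x (Suc n) = (\<Sum>y\<in>verts G. num_arcs G x y * walks_to_v y n)"
proof -
  define E where "E y = {e \<in> arcs G. tail G e = x \<and> head G e = y}" for y
  define P where "P y = {p. awalk y p v \<and> length p = n}" for y
  have "{p. awalk x p v \<and> length p = Suc n} = (\<Union>y\<in>verts G. (\<lambda>(e, p). e # p) ` (E y \<times> P y))"
    by (auto simp: E_def P_def awalk_simps length_Suc_conv image_iff)
  also have "card \<dots> = (\<Sum>y\<in>verts G. card ((\<lambda>(e, p). e # p) ` (E y \<times> P y)))"
    by (rule card_UN_disjoint) (auto simp: E_def P_def intro!: finite_imageI finite_awalks_length)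
  also have "\<dots> = (\<Sum>y\<in>verts G. num_arcs G x y * walks_to_v y n)"
    by (intro sum.cong refl, subst card_image)
      (auto simp: inj_on_def card_cartesian_product E_def P_def num_arcs_def walks_to_v_def)
  finally show ?thesis unfolding walks_to_v_def .
qed

lemma first_returns_0: "first_returns 0 = 0"
proof -
  have "{c. first_return_loop c \<and> length c = 0} = {}" by (auto simp: first_return_loop_def)
  then show ?thesis by (simp add: first_returns_def)
qed

lemma first_returns_le_walks: "first_returns n \<le> walks_to_v v n"
  unfolding first_returns_def walks_to_v_def
  by (rule card_mono[OF finite_awalks_length]) (auto simp: first_return_loop_def)

lemma closed_walk_first_return:
  assumes "awalk v p v" "p \<noteq> []"
  obtains c q where "p = c @ q" "first_return_loop c" "awalk v q v"
proof -
  have "\<exists>e\<in>set p. head G e = v"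
    using awalk_head_last[OF assms] last_in_set[OF assms(2)] by blast
  then obtain a e q where p: "p = a @ e # q" "head G e = v" "\<forall>f\<in>set a. head G f \<noteq> v"
    by (rule split_list_first_propE)
  have "awalk v (a @ [e]) v" "awalk v q v"
    using assms(1) p(2) unfolding p(1) by (auto simp: awalk_simps)
  then show ?thesis using that[of "a @ [e]" q] p by (auto simp: first_return_loop_def)
qed

text \<open>The renewal equation: a nonempty closed walk at \<open>v\<close> splits uniquely into its first-return
  loop and a closed walk.\<close>

lemma walks_renewal:
  assumes "n > 0"
  shows "walks_to_v v n = (\<Sum>i\<le>n. first_returns i * walks_to_v v (n - i))"
proof -
  define K where "K i = {c. first_return_loop c \<and> length c = i}" for i
  define P where "P i = {p. awalk v p v \<and> length p = i}" for i
  have fin: "finite (K i)" "finite (P i)" for i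
    unfolding K_def P_def by (rule finite_first_return_loops finite_awalks_length)+
  have "P n = (\<Union>i\<in>{..n}. (\<lambda>(c, q). c @ q) ` (K i \<times> P (n - i)))" (is "_ = ?U")
  proof
    show "P n \<subseteq> ?U"
    proof
      fix p assume "p \<in> P n"
      then have p: "awalk v p v" "length p = n" "p \<noteq> []" using assms by (auto simp: P_def)
      obtain c q where "p = c @ q" "first_return_loop c" "awalk v q v"
        by (rule closed_walk_first_return[OF p(1,3)])
      with p(2) show "p \<in> ?U"
        by (intro UN_I[of "length c"] image_eqI[of _ _ "(c, q)"]) (auto simp: K_def P_def)
    qed
  qed (auto simp: K_def P_def first_return_loop_def intro: awalk_appendI)
  moreover have "((\<lambda>(c, q). c @ q) ` (K i \<times> P (n - i))) \<inter> ((\<lambda>(c, q). c @ q) ` (K j \<times> P (n - j))) = {}"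
    if "i \<noteq> j" for i j
  proof (rule Int_emptyI)
    fix p
    assume "p \<in> (\<lambda>(c, q). c @ q) ` (K i \<times> P (n - i))" "p \<in> (\<lambda>(c, q). c @ q) ` (K j \<times> P (n - j))"
    then obtain c q d q' where "c \<in> K i" "d \<in> K j" "c @ q = d @ q'" by auto
    then show False using first_return_loop_prefix_free[of c d q q'] that by (auto simp: K_def)
  qed
  ultimately have "card (P n) = (\<Sum>i\<le>n. card ((\<lambda>(c, q). c @ q) ` (K i \<times> P (n - i))))"
    using fin by (simp add: card_UN_disjoint)
  also have "\<dots> = (\<Sum>i\<le>n. card (K i \<times> P (n - i)))"
  proof (intro sum.cong refl card_image)
    fix i
    show "inj_on (\<lambda>(c, q). c @ q) (K i \<times> P (n - i))"
      by (auto simp: inj_on_def K_def)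
  qed
  finally show ?thesis
    by (simp add: card_cartesian_product K_def P_def walks_to_v_def first_returns_def)
qed

abbreviation N where "N \<equiv> card (verts G)"
abbreviation vert_of where "vert_of \<equiv> from_nat_into (verts G)"
abbreviation index_of where "index_of \<equiv> to_nat_on (verts G)"

lemma index_of_less: "x \<in> verts G \<Longrightarrow> index_of x < N"
  using to_nat_on_finite[OF finite_verts] by (auto simp: bij_betw_def)

lemma vert_of_index_of: "x \<in> verts G \<Longrightarrow> vert_of (index_of x) = x"
  by (simp add: countable_finite)

lemma vert_of_in_verts: "i < N \<Longrightarrow> vert_of i \<in> verts G"
  using v_in_verts by (intro from_nat_into) auto

lemma bij_vert_of: "bij_betw vert_of {..<N} (verts G)"
  using bij_betw_from_nat_into_finite[OF finite_verts] .

lemma vert_of_eq_v_iff: "i < N \<Longrightarrow> vert_of i = v \<longleftrightarrow> i = index_of v"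
  using bij_betw_imp_inj_on[OF bij_vert_of] index_of_less[OF v_in_verts]
    vert_of_index_of[OF v_in_verts] by (metis inj_onD lessThan_iff)

lemma sum_vert_of: "(\<Sum>y\<in>verts G. f y) = (\<Sum>k<N. f (vert_of k))"
  using sum.reindex_bij_betw[OF bij_vert_of, of f] by simp

lemma adjacency_mat_carrier: "adjacency_mat G \<in> carrier_mat N N"
  by (simp add: adjacency_mat_def)

lemma adjacency_pow_entry:
  assumes "i < N"
  shows "(adjacency_mat G ^\<^sub>m n :: complex mat) $$ (i, index_of v) = of_nat (walks_to_v (vert_of i) n)"
  using assms
proof (induction n arbitrary: i)
  case 0
  then show ?case
    using index_of_less[OF v_in_verts] vert_of_in_verts vert_of_eq_v_iff
    by (simp add: walks_to_v_0 adjacency_mat_def)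
next
  case (Suc n)
  let ?A = "adjacency_mat G :: complex mat"
  have A: "?A \<in> carrier_mat N N" by (rule adjacency_mat_carrier)
  have "(?A ^\<^sub>m Suc n) $$ (i, index_of v) = (\<Sum>k<N. ?A $$ (i, k) * (?A ^\<^sub>m n) $$ (k, index_of v))"
    unfolding pow_mat_Suc_left[OF A] using A pow_carrier_mat[OF A, of n] Suc.prems
      index_of_less[OF v_in_verts]
    by (auto simp: scalar_prod_def lessThan_atLeast0 simp del: pow_mat.simps)
  also have "\<dots> = (\<Sum>k<N. of_nat (num_arcs G (vert_of i) (vert_of k)) * of_nat (walks_to_v (vert_of k) n))"
    using Suc by (intro sum.cong) (auto simp: adjacency_mat_def)
  finally show ?case by (simp add: walks_to_v_Suc sum_vert_of)
qed

lemma walks_bounded: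
  assumes t: "0 < t" "t * spectral_radius (adjacency_mat G) < 1"
  obtains b where "\<And>x n. x \<in> verts G \<Longrightarrow> real (walks_to_v x n) * t ^ n \<le> b"
proof -
  define A :: "complex mat" where "A = adjacency_mat G"
  have A: "A \<in> carrier_mat N N" unfolding A_def by (rule adjacency_mat_carrier)
  have N: "N > 0" using v_in_verts by (auto simp: card_gt_0_iff)
  define B where "B = complex_of_real t \<cdot>\<^sub>m A"
  have B: "B \<in> carrier_mat N N" unfolding B_def using A by simp
  obtain \<mu> where \<mu>: "\<mu> \<in> spectrum B" "spectral_radius B = norm \<mu>"
    using spectral_radius_mem_max(1)[OF B N] by auto
  then obtain x where x: "eigenvector B x \<mu>" by (auto simp: spectrum_def eigenvalue_def)
  then have dim: "x \<in> carrier_vec N" and x0: "x \<noteq> 0\<^sub>v N" and Bx: "B *\<^sub>v x = \<mu> \<cdot>\<^sub>v x"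
    using B by (auto simp: eigenvector_def)
  have "A *\<^sub>v x = (\<mu> / t) \<cdot>\<^sub>v x"
  proof -
    have "B *\<^sub>v x = complex_of_real t \<cdot>\<^sub>v (A *\<^sub>v x)"
      using A dim by (intro eq_vecI) (auto simp: B_def)
    then have "complex_of_real t \<cdot>\<^sub>v (A *\<^sub>v x) = \<mu> \<cdot>\<^sub>v x" using Bx by simp
    then have "(1 / complex_of_real t) \<cdot>\<^sub>v (complex_of_real t \<cdot>\<^sub>v (A *\<^sub>v x))
        = (1 / complex_of_real t) \<cdot>\<^sub>v (\<mu> \<cdot>\<^sub>v x)" by simp
    then show ?thesis using t by (simp add: smult_smult_assoc)
  qed
  then have "\<mu> / t \<in> spectrum A"
    using A dim x0 by (auto simp: spectrum_def eigenvalue_def eigenvector_def)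
  then have "norm (\<mu> / t) \<le> spectral_radius A" using spectral_radius_mem_max(2)[OF A N] by blast
  then have "spectral_radius B \<le> t * spectral_radius A"
    using t \<mu> by (simp add: norm_divide field_simps)
  then have "spectral_radius B < 1" using t unfolding A_def by linarith
  then obtain b where b: "\<And>k. norm_bound (B ^\<^sub>m k) b"
    using spectral_radius_jnf_norm_bound_less_1_upper_triangular[OF B] by blast
  show ?thesis
  proof (rule that)
    fix x n assume x: "x \<in> verts G"
    have "norm ((B ^\<^sub>m n) $$ (index_of x, index_of v)) \<le> b"
      using b[of n] index_of_less[OF x] index_of_less[OF v_in_verts] B
      unfolding norm_bound_def by auto
    also have "(B ^\<^sub>m n) $$ (index_of x, index_of v)
        = complex_of_real t ^ n * (A ^\<^sub>m n) $$ (index_of x, index_of v)"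
      unfolding B_def smult_pow_mat[OF A]
      using index_of_less[OF x] index_of_less[OF v_in_verts] A by auto
    also have "(A ^\<^sub>m n) $$ (index_of x, index_of v) = of_nat (walks_to_v x n)"
      unfolding A_def using adjacency_pow_entry[OF index_of_less[OF x]] vert_of_index_of[OF x] by simp
    finally show "real (walks_to_v x n) * t ^ n \<le> b"
      using t by (simp add: norm_mult norm_power mult.commute)
  qed
qed

lemma summable_walks:
  assumes z: "0 \<le> z" "z * spectral_radius (adjacency_mat G) < 1" and x: "x \<in> verts G"
  shows "summable (\<lambda>n. real (walks_to_v x n) * z ^ n)"
proof -
  define s where "s = spectral_radius (adjacency_mat G)"
  have "((\<lambda>t. t * s) \<longlongrightarrow> z * s) (at_right z)" by (intro tendsto_intros)
  then have "\<forall>\<^sub>F t in at_right z. t * s < 1 \<and> z < t"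
    using z(2) unfolding s_def[symmetric]
    by (intro eventually_conj order_tendstoD(2)) (auto simp: eventually_at_right_less)
  then obtain t where t: "t * s < 1" "z < t"
    using eventually_happens[of _ "at_right z"] trivial_limit_at_right_real by blast
  then have "0 < t" using z(1) by linarith
  then obtain b where b: "\<And>n. real (walks_to_v x n) * t ^ n \<le> b"
    using walks_bounded t(1) x unfolding s_def by metis
  have "norm (real (walks_to_v x n) * z ^ n) \<le> b * (z / t) ^ n" for n
  proof -
    have "real (walks_to_v x n) * z ^ n = real (walks_to_v x n) * t ^ n * (z / t) ^ n"
      using \<open>0 < t\<close> by (simp add: power_divide)
    also have "\<dots> \<le> b * (z / t) ^ n" using b[of n] z \<open>0 < t\<close> by (intro mult_right_mono) auto
    finally show ?thesis using z by simp
  qed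
  moreover have "summable (\<lambda>n. b * (z / t) ^ n)"
    using t(2) z(1) \<open>0 < t\<close> by (intro summable_mult summable_geometric) auto
  ultimately show ?thesis by (rule summable_comparison_test'[rotated])
qed

text \<open>The adjugate of \<open>I - A z\<close> over the polynomials, evaluated at \<open>z\<close>, solves the linear system
  \<open>(I - A z) f = b\<close> up to the factor \<open>p(z)\<close>.\<close>

lemma adjugate_solve:
  fixes f b :: "nat \<Rightarrow> 'a :: {real_algebra_1, comm_ring_1}"
  assumes system: "\<And>j. j < N \<Longrightarrow>
      f j - of_real z * (\<Sum>k<N. of_nat (num_arcs G (vert_of j) (vert_of k)) * f k) = b j"
    and i: "i < N"
  shows "of_real (poly (p_poly G) z) * f i
      = (\<Sum>j<N. of_real (poly (adj_mat (I_minus_Az G) $$ (i, j)) z) * b j)"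
proof -
  define M where "M = I_minus_Az G"
  have M: "M \<in> carrier_mat N N" 
    unfolding M_def I_minus_Az_def
    by (intro minus_carrier_mat smult_carrier_mat adjacency_mat_carrier)
  note adj = adj_mat(1)[OF M]
  have entry: "poly (M $$ (j, k)) z
      = (if j = k then 1 else 0) - z * real (num_arcs G (vert_of j) (vert_of k))"
    if "j < N" "k < N" for j k
  proof -
    have "M $$ (j, k) = (if j = k then 1 else 0)
        - [:0, 1:] * of_nat (num_arcs G (vert_of j) (vert_of k))"
      using that by (simp add: M_def I_minus_Az_def adjacency_mat_def)
    then show ?thesis by (simp add: of_nat_poly)
  qed
  have row: "(\<Sum>k<N. of_real (poly (M $$ (j, k)) z) * f k) = b j" if j: "j < N" for j
  proof -
    have "(\<Sum>k<N. of_real (poly (M $$ (j, k)) z) * f k)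
        = (\<Sum>k<N. (if j = k then f k else 0)
            - of_real z * (of_nat (num_arcs G (vert_of j) (vert_of k)) * f k))"
      using j by (intro sum.cong) (auto simp: entry algebra_simps)
    also have "\<dots> = b j"
      using j system[OF j] by (simp add: sum_subtractf sum_distrib_left)
    finally show ?thesis .
  qed
  have adj_times: "(\<Sum>j<N. adj_mat M $$ (i, j) * M $$ (j, k)) = (if i = k then p_poly G else 0)"
    if k: "k < N" for k
  proof -
    have "(\<Sum>j<N. adj_mat M $$ (i, j) * M $$ (j, k)) = (adj_mat M * M) $$ (i, k)"
      using M adj i k by (simp add: scalar_prod_def lessThan_atLeast0)
    also have "\<dots> = (if i = k then det M else 0)"
      using M i k by (simp add: adj_mat(3)[OF M])
    also have "det M = p_poly G" by (simp add: p_poly_def M_def)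
    finally show ?thesis .
  qed
  have "(\<Sum>j<N. of_real (poly (adj_mat M $$ (i, j)) z) * b j)
      = (\<Sum>j<N. \<Sum>k<N. of_real (poly (adj_mat M $$ (i, j)) z) * (of_real (poly (M $$ (j, k)) z) * f k))"
  proof (intro sum.cong refl)
    fix j assume "j \<in> {..<N}"
    then have "b j = (\<Sum>k<N. of_real (poly (M $$ (j, k)) z) * f k)" by (simp add: row)
    then show "of_real (poly (adj_mat M $$ (i, j)) z) * b j
        = (\<Sum>k<N. of_real (poly (adj_mat M $$ (i, j)) z) * (of_real (poly (M $$ (j, k)) z) * f k))"
      by (simp only: sum_distrib_left)
  qed
  also have "\<dots> = (\<Sum>k<N. \<Sum>j<N. of_real (poly (adj_mat M $$ (i, j)) z) * (of_real (poly (M $$ (j, k)) z) * f k))"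
    by (rule sum.swap)
  also have "\<dots> = (\<Sum>k<N. of_real (poly (\<Sum>j<N. adj_mat M $$ (i, j) * M $$ (j, k)) z) * f k)"
    by (simp add: poly_sum sum_distrib_right mult.assoc)
  also have "\<dots> = (\<Sum>k<N. if i = k then of_real (poly (p_poly G) z) * f k else 0)"
    by (intro sum.cong) (auto simp: adj_times)
  also have "\<dots> = of_real (poly (p_poly G) z) * f i" using i by simp
  finally show ?thesis unfolding M_def by simp
qed

lemma p_poly_root:
  assumes "eigenvalue (adjacency_mat G) (complex_of_real r)" "r \<noteq> 0"
  shows "poly (p_poly G) (inverse r) = 0"
proof -
  define A :: "complex mat" where "A = adjacency_mat G"
  have A: "A \<in> carrier_mat N N" unfolding A_def by (rule adjacency_mat_carrier)
  obtain x where x: "x \<in> carrier_vec N" "x \<noteq> 0\<^sub>v N" "A *\<^sub>v x = complex_of_real r \<cdot>\<^sub>v x"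
    using assms(1) A unfolding A_def[symmetric] eigenvalue_def eigenvector_def by auto
  then obtain i where i: "i < N" "x $ i \<noteq> 0" by (metis carrier_vecD eq_vecI index_zero_vec)
  have "x $ j - of_real (inverse r) * (\<Sum>k<N. of_nat (num_arcs G (vert_of j) (vert_of k)) * x $ k) = 0"
    if j: "j < N" for j
  proof -
    have "(\<Sum>k<N. of_nat (num_arcs G (vert_of j) (vert_of k)) * x $ k) = (A *\<^sub>v x) $ j"
      using j x(1) A by (simp add: A_def adjacency_mat_def scalar_prod_def lessThan_atLeast0)
    also have "\<dots> = of_real r * x $ j" using j x by simp
    finally show ?thesis using assms(2) by simp
  qed
  from adjugate_solve[of "\<lambda>j. x $ j" "inverse r" "\<lambda>_. 0", OF this i(1)] i(2)
  show ?thesis by simp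
qed

text \<open>The vector of the generating functions of the walks to \<open>v\<close> solves the system whose
  right-hand side is the unit vector at \<open>v\<close>.\<close>

lemma walks_series_determinants:
  assumes z: "0 \<le> z" "z * spectral_radius (adjacency_mat G) < 1"
  shows "poly (p_poly G) z * (\<Sum>n. real (walks_to_v v n) * z ^ n) = poly (p_del G v) z"
proof -
  define W where "W x = (\<Sum>n. real (walks_to_v x n) * z ^ n)" for x
  have W: "W x = (if x = v then 1 else 0) + z * (\<Sum>y\<in>verts G. real (num_arcs G x y) * W y)"
    if x: "x \<in> verts G" for x
  proof -
    have "W x = (if x = v then 1 else 0) + (\<Sum>n. real (walks_to_v x (Suc n)) * z ^ Suc n)"
      unfolding W_def using suminf_split_head[OF summable_walks[OF z x]] walks_to_v_0[OF x] by simp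
    moreover have "(\<lambda>n. real (walks_to_v x (Suc n)) * z ^ Suc n) sums (z * (\<Sum>y\<in>verts G. real (num_arcs G x y) * W y))"
    proof -
      have "real (walks_to_v x (Suc n)) * z ^ Suc n
          = z * (\<Sum>y\<in>verts G. real (num_arcs G x y) * (real (walks_to_v y n) * z ^ n))" for n
        by (simp add: walks_to_v_Suc sum_distrib_right mult.assoc mult.left_commute[of _ z])
      moreover have "(\<lambda>n. z * (\<Sum>y\<in>verts G. real (num_arcs G x y) * (real (walks_to_v y n) * z ^ n)))
          sums (z * (\<Sum>y\<in>verts G. real (num_arcs G x y) * W y))"
        unfolding W_def by (intro sums_mult sums_sum summable_sums summable_walks[OF z])
      ultimately show ?thesis by (simp only:)
    qed
    then have "(\<Sum>n. real (walks_to_v x (Suc n)) * z ^ Suc n) = z * (\<Sum>y\<in>verts G. real (num_arcs G x y) * W y)"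
      by (rule sums_unique[symmetric])
    ultimately show ?thesis by simp
  qed
  have "W (vert_of j) - of_real z * (\<Sum>k<N. of_nat (num_arcs G (vert_of j) (vert_of k)) * W (vert_of k))
      = (if j = index_of v then 1 else 0)" if "j < N" for j
    using W[OF vert_of_in_verts[OF that]] vert_of_eq_v_iff[OF that] by (simp add: sum_vert_of)
  from adjugate_solve[of "\<lambda>j. W (vert_of j)" z, OF this index_of_less[OF v_in_verts]]
  have "poly (p_poly G) z * W v = poly (adj_mat (I_minus_Az G) $$ (index_of v, index_of v)) z"
    using index_of_less[OF v_in_verts] vert_of_index_of[OF v_in_verts]
    by (simp add: if_distrib[of "\<lambda>b. _ * b"] cong: if_cong)
  also have "adj_mat (I_minus_Az G) $$ (index_of v, index_of v) = p_del G v"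
    using index_of_less[OF v_in_verts]
    by (simp add: adj_mat_def cofactor_def p_del_def I_minus_Az_def adjacency_mat_def flip: mult_2)
  finally show ?thesis unfolding W_def .
qed

end

section \<open>Power series with nonnegative coefficients and values of rational functions\<close>

lemma summable_power_le:
  fixes a :: "nat \<Rightarrow> real"
  assumes "\<And>n. 0 \<le> a n" "summable (\<lambda>n. a n * y ^ n)" "0 \<le> x" "x \<le> y"
  shows "summable (\<lambda>n. a n * x ^ n)"
  by (rule summable_comparison_test'[OF assms(2), of 0])
    (use assms in \<open>auto intro!: mult_left_mono power_mono\<close>)

lemma continuous_on_nonneg_power_series:
  fixes a :: "nat \<Rightarrow> real"
  assumes a: "\<And>n. 0 \<le> a n" and y: "summable (\<lambda>n. a n * y ^ n)"
  shows "continuous_on {0..y} (\<lambda>x. \<Sum>n. a n * x ^ n)"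
proof (rule uniform_limit_theorem)
  show "uniform_limit {0..y} (\<lambda>n x. \<Sum>i<n. a i * x ^ i) (\<lambda>x. \<Sum>n. a n * x ^ n) sequentially"
    by (rule Weierstrass_m_test[OF _ y]) (use a in \<open>auto intro!: mult_left_mono power_mono\<close>)
  show "\<forall>\<^sub>F n in sequentially. continuous_on {0..y} (\<lambda>x. \<Sum>i<n. a i * x ^ i)"
    by (intro always_eventually allI continuous_intros)
qed simp

text \<open>Convexity: the slopes of such a series increase. It suffices to check this for each
  monomial, whose difference quotient is the sum of the products \<open>x\<^sup>i y\<^sup>j\<close> with
  \<open>i + j = n - 1\<close> and so increases in both points.\<close>

lemma nonneg_power_series_slope_mono:
  fixes a :: "nat \<Rightarrow> real"
  defines "F \<equiv> \<lambda>x. \<Sum>n. a n * x ^ n"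
  assumes a: "\<And>n. 0 \<le> a n" and y: "summable (\<lambda>n. a n * y ^ n)"
    and le: "0 \<le> x1" "x1 < x2" "x2 \<le> y" "x1 \<le> z" "z < y"
  shows "(F x2 - F x1) / (x2 - x1) \<le> (F y - F z) / (y - z)"
proof -
  note sm = summable_power_le[OF a y]
  have diff: "F s - F t = (\<Sum>n. a n * (s ^ n - t ^ n))" "summable (\<lambda>n. a n * (s ^ n - t ^ n))"
    if "0 \<le> s" "s \<le> y" "0 \<le> t" "t \<le> y" for s t
    using suminf_diff[OF sm[of s] sm[of t]] summable_diff[OF sm[of s] sm[of t]] that
    unfolding F_def by (simp_all add: right_diff_distrib)
  have "(y - z) * (F x2 - F x1) = (\<Sum>n. (y - z) * (a n * (x2 ^ n - x1 ^ n)))"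
    using diff[of x2 x1] le by (simp add: suminf_mult)
  also have "\<dots> \<le> (\<Sum>n. (x2 - x1) * (a n * (y ^ n - z ^ n)))"
  proof (rule suminf_le)
    fix n
    have "(\<Sum>i<n. x1 ^ (n - Suc i) * x2 ^ i) \<le> (\<Sum>i<n. z ^ (n - Suc i) * y ^ i)"
      using le by (intro sum_mono mult_mono power_mono) auto
    then have "a n * ((y - z) * (x2 - x1)) * (\<Sum>i<n. x1 ^ (n - Suc i) * x2 ^ i)
        \<le> a n * ((y - z) * (x2 - x1)) * (\<Sum>i<n. z ^ (n - Suc i) * y ^ i)"
      using le a[of n] by (intro mult_left_mono) auto
    then show "(y - z) * (a n * (x2 ^ n - x1 ^ n)) \<le> (x2 - x1) * (a n * (y ^ n - z ^ n))"
      by (simp add: power_diff_sumr2 mult_ac)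
  next
    show "summable (\<lambda>n. (y - z) * (a n * (x2 ^ n - x1 ^ n)))"
      "summable (\<lambda>n. (x2 - x1) * (a n * (y ^ n - z ^ n)))"
      using diff(2)[of x2 x1] diff(2)[of y z] le by (auto intro: summable_mult)
  qed
  also have "\<dots> = (x2 - x1) * (F y - F z)"
    using diff[of y z] le by (simp add: suminf_mult)
  finally have "(F x2 - F x1) * (y - z) \<le> (F y - F z) * (x2 - x1)" by (simp only: mult.commute)
  then show ?thesis using le by (simp add: pos_divide_le_eq pos_le_divide_eq)
qed

text \<open>If \<open>P = Q \<phi>\<close> to the left of \<open>R\<close>, then the same holds for the reduced representation
  \<open>a / b\<close> of \<open>P / Q\<close>, first off the zeros of \<open>Q\<close> and then at \<open>R\<close> by continuity. Now
  \<open>b(R) = 0\<close> would imply \<open>a(R) = 0\<close>, contradicting coprimality.\<close>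

lemma ratfun_eval_eq:
  fixes P Q :: "real poly"
  assumes Q: "Q \<noteq> 0" and R: "0 < R"
    and eq: "\<And>z. 0 \<le> z \<Longrightarrow> z < R \<Longrightarrow> poly P z = poly Q z * \<phi> z"
    and lim: "(\<phi> \<longlongrightarrow> \<phi> R) (at_left R)"
  shows "ratfun_eval (to_fract P / to_fract Q) R = \<phi> R"
proof -
  define f where "f = to_fract P / to_fract Q"
  obtain a b where ab: "quot_of_fract f = (a, b)" by (cases "quot_of_fract f")
  have b: "b \<noteq> 0" and cop: "coprime a b"
    using snd_quot_of_fract_nonzero[of f] coprime_quot_of_fract[of f] unfolding ab by auto
  have "f = to_fract a / to_fract b"
    using Fract_quot_of_fract[of f] by (simp add: ab Fract_conv_to_fract)
  then have "to_fract (P * b) = to_fract (a * Q)"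
    using Q b by (simp add: f_def field_simps)
  then have cross: "P * b = a * Q" by (simp only: to_fract_eq_iff)
  have "\<forall>\<^sub>F z in at_left R. poly Q z \<noteq> 0"
  proof -
    have "open (- ({z. poly Q z = 0} - {R}))"
      using poly_roots_finite[OF Q] by (intro open_Compl finite_imp_closed) simp
    then have "\<forall>\<^sub>F z in nhds R. z \<in> - ({z. poly Q z = 0} - {R})"
      by (rule eventually_nhds_in_open) simp
    then show ?thesis unfolding eventually_at_filter by eventually_elim auto
  qed
  moreover have "\<forall>\<^sub>F z in at_left R. 0 \<le> z \<and> z < R"
    using R eventually_at_left_field[of "\<lambda>z. 0 \<le> z \<and> z < R" R] by (meson less_eq_real_def)
  ultimately have "\<forall>\<^sub>F z in at_left R. poly a z = poly b z * \<phi> z"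
  proof eventually_elim
    case (elim z)
    have "poly P z * poly b z = poly a z * poly Q z" using cross by (metis poly_mult)
    then show ?case using elim eq[of z] by (simp add: mult.commute)
  qed
  moreover have "((\<lambda>z. poly b z * \<phi> z) \<longlongrightarrow> poly b R * \<phi> R) (at_left R)"
    by (intro tendsto_intros lim)
  ultimately have "((\<lambda>z. poly a z) \<longlongrightarrow> poly b R * \<phi> R) (at_left R)"
    by (rule tendsto_cong[THEN iffD2])
  moreover have "((\<lambda>z. poly a z) \<longlongrightarrow> poly a R) (at_left R)" by (intro tendsto_intros)
  ultimately have val: "poly a R = poly b R * \<phi> R"
    by (intro tendsto_unique[of "at_left R"]) auto
  have "poly b R \<noteq> 0"
  proof
    assume "poly b R = 0"
    then have "poly a R = 0" using val by simp
    then have "[:-R, 1:] dvd a" "[:-R, 1:] dvd b"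
      using \<open>poly b R = 0\<close> by (simp_all only: poly_eq_0_iff_dvd)
    then show False using coprime_common_divisor[OF cop, of "[:-R, 1:]"] by (simp add: is_unit_iff_degree)
  qed
  then show ?thesis using val by (simp add: ratfun_eval_def ab flip: f_def)
qed

section \<open>The first-return series\<close>

context pointed_fin_digraph
begin


definition first_return_series :: "real \<Rightarrow> real" where
  "first_return_series z = (\<Sum>n. real (first_returns n) * z ^ n)"

lemma p_poly_at_0: "poly (p_poly G) 0 = 1"
proof -
  have "map_mat (\<lambda>p. poly p 0) (I_minus_Az G) = (1\<^sub>m N :: real mat)"
    by (rule eq_matI) (auto simp: I_minus_Az_def adjacency_mat_def)
  moreover have "comm_ring_hom (\<lambda>p :: real poly. poly p 0)" by unfold_locales auto
  ultimately show ?thesis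
    using comm_ring_hom.hom_det[of "\<lambda>p :: real poly. poly p 0" "I_minus_Az G"]
    by (simp add: p_poly_def)
qed

lemma p_del_at_0: "poly (p_del G v) 0 = 1"
  using walks_series_determinants[of 0] suminf_finite[of "{0}" "\<lambda>n. real (walks_to_v v n) * 0 ^ n"]
  by (simp add: p_poly_at_0 walks_to_v_0[OF v_in_verts])

lemma p_del_nonzero: "p_del G v \<noteq> 0"
  using p_del_at_0 by auto

text \<open>With \<open>W\<close> the generating function of the closed walks, the renewal equation reads
  \<open>W = 1 + F W\<close>; hence \<open>1 - F = 1 / W > 0\<close>, and \<open>p\<^sub>v = p W\<close> turns into \<open>p = p\<^sub>v (1 - F)\<close>.\<close>

lemma first_return_series_inside:
  assumes z: "0 \<le> z" "z * spectral_radius (adjacency_mat G) < 1"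
  shows "summable (\<lambda>n. real (first_returns n) * z ^ n)"
    and "first_return_series z < 1"
    and "poly (p_poly G) z = poly (p_del G v) z * (1 - first_return_series z)"
proof -
  let ?a = "\<lambda>n. real (first_returns n) * z ^ n" and ?w = "\<lambda>n. real (walks_to_v v n) * z ^ n"
  define W where "W = suminf ?w"
  have w: "summable ?w" by (rule summable_walks[OF z v_in_verts])
  show a: "summable ?a"
    by (rule summable_comparison_test'[OF w, of 0])
      (use z first_returns_le_walks in \<open>auto intro!: mult_right_mono\<close>)
  have w0: "?w 0 = 1" by (simp add: walks_to_v_0[OF v_in_verts])
  have "(\<lambda>n. \<Sum>i\<le>n. ?a i * ?w (n - i)) sums (first_return_series z * W)"
    unfolding first_return_series_def W_def
    using a w z by (intro Cauchy_product_sums) auto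
  moreover have "(\<Sum>i\<le>n. ?a i * ?w (n - i)) = (if n = 0 then 0 else ?w n)" for n
  proof (cases "n = 0")
    case False
    have "(\<Sum>i\<le>n. ?a i * ?w (n - i)) = (\<Sum>i\<le>n. real (first_returns i * walks_to_v v (n - i)) * z ^ n)"
    proof (intro sum.cong refl)
      fix i assume "i \<in> {..n}"
      then have "z ^ n = z ^ i * z ^ (n - i)" by (simp flip: power_add)
      then show "?a i * ?w (n - i) = real (first_returns i * walks_to_v v (n - i)) * z ^ n"
        by (simp only: of_nat_mult mult_ac)
    qed
    also have "\<dots> = real (\<Sum>i\<le>n. first_returns i * walks_to_v v (n - i)) * z ^ n"
      by (simp add: sum_distrib_right)
    also have "\<dots> = ?w n" using walks_renewal[of n] False by simp
    finally show ?thesis using False by simp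
  qed (simp add: first_returns_0)
  moreover have "(\<lambda>n. if n = 0 then 0 else ?w n) sums (W - 1)"
    using sums_diff[OF summable_sums[OF w] sums_single[of 0 "\<lambda>_. 1 :: real"]] w0
    unfolding W_def by (rule_tac back_subst[of "\<lambda>f. f sums _"]) (auto simp: fun_eq_iff)
  ultimately have renewal: "first_return_series z * W = W - 1"
    using sums_unique2 by simp
  have "1 \<le> W"
    unfolding W_def using sum_le_suminf[OF w, of "{0}"] z w0 by simp
  then have inv: "1 - first_return_series z = 1 / W" using renewal by (simp add: field_simps)
  then show "first_return_series z < 1" using \<open>1 \<le> W\<close> by (smt (verit) zero_less_divide_1_iff)
  show "poly (p_poly G) z = poly (p_del G v) z * (1 - first_return_series z)"
    using walks_series_determinants[OF z] \<open>1 \<le> W\<close> unfolding inv W_def by (simp add: field_simps)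
qed

text \<open>The numbers \<open>a\<^sub>n\<close> of first-return loops are natural numbers with the sum \<open>F(1) < 1\<close>.\<close>

lemma no_first_returns_if_small_radius:
  assumes "spectral_radius (adjacency_mat G) < 1"
  shows "first_returns n = 0"
proof -
  have one: "0 \<le> (1 :: real)" "1 * spectral_radius (adjacency_mat G) < 1" using assms by auto
  have "real (first_returns n) \<le> first_return_series 1"
    using sum_le_suminf[OF first_return_series_inside(1)[OF one], of "{n}"]
    by (simp add: first_return_series_def)
  then show ?thesis using first_return_series_inside(2)[OF one] by linarith
qed

text \<open>Then \<open>F = 0\<close>, so that \<open>p = p\<^sub>v\<close> on \<open>[0, 1]\<close> and hence as polynomials, and \<open>q\<^sub>v = 1\<close>. This excludes radii
  below \<open>1\<close>, so that \<open>\<rho> \<le> 1\<close> and \<open>\<rho>\<^sup>2 \<le> \<rho>\<close>.\<close>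

lemma ratfun_eval_q_if_small_radius:
  assumes "spectral_radius (adjacency_mat G) < 1"
  shows "ratfun_eval (q_fract G v) z = 1"
proof -
  have "first_return_series x = 0" for x
    by (simp add: first_return_series_def no_first_returns_if_small_radius[OF assms])
  moreover have "x * spectral_radius (adjacency_mat G) < 1" if "0 \<le> x" "x \<le> 1" for x
  proof (cases "0 \<le> spectral_radius (adjacency_mat G)")
    case True
    then show ?thesis using that assms mult_right_mono[of x 1 "spectral_radius (adjacency_mat G)"] by simp
  next
    case False
    then show ?thesis using that mult_nonneg_nonpos[of x "spectral_radius (adjacency_mat G)"] by linarith
  qed
  ultimately have sub: "{0..1} \<subseteq> {x. poly (p_poly G - p_del G v) x = 0}"
    using first_return_series_inside(3) by auto
  have "\<not> finite {0..1 :: real}" by (rule infinite_Icc) simp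
  then have "\<not> finite {x. poly (p_poly G - p_del G v) x = 0}"
    by (rule contrapos_nn) (rule finite_subset[OF sub])
  then have "p_poly G = p_del G v" using poly_roots_finite[of "p_poly G - p_del G v"] by auto
  then show ?thesis by (simp add: q_fract_def ratfun_eval_def p_del_nonzero)
qed

context
  fixes r \<rho> :: real
  assumes r: "r = spectral_radius (adjacency_mat G)" "1 \<le> r" and \<rho>: "\<rho> = inverse r"
begin

lemma rho_bounds: "0 < \<rho>" "\<rho> \<le> 1" "\<rho>\<^sup>2 \<le> \<rho>"
proof -
  show "0 < \<rho>" "\<rho> \<le> 1" using r by (auto simp: \<rho> inverse_le_1_iff)
  then show "\<rho>\<^sup>2 \<le> \<rho>" by (simp add: power2_eq_square mult_left_le_one_le)
qed

lemma inside_if_less_rho: "z < \<rho> \<Longrightarrow> z * spectral_radius (adjacency_mat G) < 1"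
  using r by (simp add: \<rho> field_simps)

text \<open>At \<open>\<rho>\<close> itself the first-return series still converges, because \<open>F < 1\<close> to the left of \<open>\<rho>\<close>
  bounds its partial sums.\<close>

lemma summable_first_returns_rho: "summable (\<lambda>n. real (first_returns n) * \<rho> ^ n)"
proof (rule bounded_imp_summable)
  fix n
  have ev: "\<forall>\<^sub>F z in at_left \<rho>. (\<Sum>i\<le>n. real (first_returns i) * z ^ i) \<le> 1"
    unfolding eventually_at_left_field
  proof (intro exI conjI allI impI)
    show "0 < \<rho>" by (rule rho_bounds)
    fix z assume z: "0 < z" "z < \<rho>"
    have "(\<Sum>i\<le>n. real (first_returns i) * z ^ i) \<le> first_return_series z"
      unfolding first_return_series_def
      using z inside_if_less_rho by (intro sum_le_suminf first_return_series_inside) auto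
    then show "(\<Sum>i\<le>n. real (first_returns i) * z ^ i) \<le> 1"
      using first_return_series_inside(2)[of z] z inside_if_less_rho by fastforce
  qed
  show "(\<Sum>i\<le>n. real (first_returns i) * \<rho> ^ i) \<le> 1"
    by (rule tendsto_upperbound[OF _ ev]) (auto intro!: tendsto_intros)
qed (use rho_bounds in auto)

lemma continuous_on_first_return_series: "continuous_on {0..\<rho>} first_return_series"
  unfolding first_return_series_def
  by (rule continuous_on_nonneg_power_series[OF _ summable_first_returns_rho]) simp

lemma first_return_series_at_left:
  assumes "0 < R" "R \<le> \<rho>"
  shows "(first_return_series \<longlongrightarrow> first_return_series R) (at_left R)"
proof -
  have "continuous_on {0..R} first_return_series"
    using continuous_on_first_return_series assms by (rule_tac continuous_on_subset) auto
  then have "(first_return_series \<longlongrightarrow> first_return_series R) (at R within {0..R})"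
    using assms by (auto simp: continuous_on_def)
  then show ?thesis using assms by (simp add: at_within_Icc_at_left)
qed

lemma ratfun_eval_q:
  assumes "0 < R" "R \<le> \<rho>"
  shows "ratfun_eval (q_fract G v) R = 1 - first_return_series R"
  unfolding q_fract_def
proof (rule ratfun_eval_eq[OF p_del_nonzero assms(1)])
  show "((\<lambda>z. 1 - first_return_series z) \<longlongrightarrow> 1 - first_return_series R) (at_left R)"
    by (intro tendsto_intros first_return_series_at_left assms)
  show "poly (p_poly G) z = poly (p_del G v) z * (1 - first_return_series z)" if "0 \<le> z" "z < R" for z
    using first_return_series_inside(3)[of z] inside_if_less_rho[of z] that assms by auto
qed

text \<open>In the nondegenerate case \<open>F = 1 - p / p\<^sub>v\<close> is differentiable from the left at \<open>\<rho>\<close>, where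
  \<open>p\<close> vanishes, with derivative \<open>- p'(\<rho>) / p\<^sub>v(\<rho>)\<close>.\<close>

lemma first_return_series_left_derivative:
  assumes root: "poly (p_poly G) \<rho> = 0" and del: "poly (p_del G v) \<rho> \<noteq> 0"
  shows "((\<lambda>z. (first_return_series \<rho> - first_return_series z) / (\<rho> - z))
    \<longlongrightarrow> - poly (pderiv (p_poly G)) \<rho> / poly (p_del G v) \<rho>) (at_left \<rho>)"
proof -
  define H where "H z = 1 - poly (p_poly G) z / poly (p_del G v) z" for z
  let ?D = "- poly (pderiv (p_poly G)) \<rho> / poly (p_del G v) \<rho>"
  have "(H has_real_derivative ?D) (at \<rho>)"
    unfolding H_def using root del
    by (auto intro!: derivative_eq_intros simp: power2_eq_square)
  then have quot: "((\<lambda>z. (H z - H \<rho>) / (z - \<rho>)) \<longlongrightarrow> ?D) (at_left \<rho>)"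
    unfolding has_field_derivative_iff by (rule tendsto_mono[OF at_le, rotated]) simp
  have ev: "\<forall>\<^sub>F z in at_left \<rho>. first_return_series z = H z \<and> z < \<rho>"
  proof -
    have "((\<lambda>z. poly (p_del G v) z) \<longlongrightarrow> poly (p_del G v) \<rho>) (at_left \<rho>)"
      by (intro tendsto_intros)
    then have "\<forall>\<^sub>F z in at_left \<rho>. poly (p_del G v) z \<noteq> 0"
      using del by (rule tendsto_imp_eventually_ne)
    moreover have "\<forall>\<^sub>F z in at_left \<rho>. 0 \<le> z \<and> z < \<rho>"
      using rho_bounds(1) eventually_at_left_field[of "\<lambda>z. 0 \<le> z \<and> z < \<rho>" \<rho>]
      by (meson less_eq_real_def)
    ultimately show ?thesis
    proof eventually_elim
      case (elim z)
      then show ?case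
        using first_return_series_inside(3)[of z] inside_if_less_rho[of z]
        by (simp add: H_def field_simps)
    qed
  qed
  have at_rho: "first_return_series \<rho> = H \<rho>"
  proof (rule tendsto_unique[of "at_left \<rho>"])
    show "(first_return_series \<longlongrightarrow> first_return_series \<rho>) (at_left \<rho>)"
      using rho_bounds by (intro first_return_series_at_left) auto
    have "(H \<longlongrightarrow> H \<rho>) (at_left \<rho>)"
      unfolding H_def using del by (intro tendsto_intros)
    then show "(first_return_series \<longlongrightarrow> H \<rho>) (at_left \<rho>)"
      by (rule tendsto_cong[THEN iffD1, rotated]) (use ev in \<open>auto elim: eventually_mono\<close>)
  qed simp
  show ?thesis
  proof (rule Lim_transform_eventually[OF quot])
    show "\<forall>\<^sub>F z in at_left \<rho>. (H z - H \<rho>) / (z - \<rho>)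
        = (first_return_series \<rho> - first_return_series z) / (\<rho> - z)"
      using ev
    proof eventually_elim
      case (elim z)
      then show ?case using minus_divide_divide[of "H \<rho> - H z" "\<rho> - z"] by (simp add: at_rho)
    qed
  qed
qed

text \<open>The bound on the partial sums passes to the limit \<open>z \<rightarrow> \<zeta> = exp (-h)\<close>. Since
  \<open>F(\<rho>\<^sup>2) > 1/4\<close>, monotonicity then places \<open>\<zeta>\<close> to the left of \<open>\<rho>\<close>.\<close>

lemma entropy_radius:
  fixes \<zeta> :: real
  assumes big: "1 / 4 < first_return_series (\<rho>\<^sup>2)"
  defines "\<zeta> \<equiv> exp (- top_entropy (vertex_subshift G v))"
  shows "\<zeta> < \<rho>" and "first_return_series (\<zeta>\<^sup>2) \<le> 1 / 4"
proof -
  have \<zeta>0: "0 < \<zeta>" unfolding \<zeta>_def by simp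
  have sm: "summable (\<lambda>n. real (first_returns n) * (\<rho>\<^sup>2) ^ n)"
    by (rule summable_power_le[OF _ summable_first_returns_rho]) (use rho_bounds in auto)
  obtain c where loop: "first_return_loop c"
  proof (rule ccontr)
    assume "\<not> thesis"
    then have "{c. first_return_loop c \<and> length c = n} = {}" for n using that by blast
    then have "first_returns n = 0" for n unfolding first_returns_def by (metis card.empty)
    then have "first_return_series (\<rho>\<^sup>2) = 0" by (simp add: first_return_series_def)
    then show False using big by simp
  qed
  have part: "(\<Sum>i\<le>n. real (first_returns i) * (\<zeta>\<^sup>2) ^ i) \<le> 1 / 4" for n
  proof (rule tendsto_upperbound)
    show "((\<lambda>z. \<Sum>i\<le>n. real (first_returns i) * (z\<^sup>2) ^ i)
        \<longlongrightarrow> (\<Sum>i\<le>n. real (first_returns i) * (\<zeta>\<^sup>2) ^ i)) (at_left \<zeta>)"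
      by (intro tendsto_intros)
    show "\<forall>\<^sub>F z in at_left \<zeta>. (\<Sum>i\<le>n. real (first_returns i) * (z\<^sup>2) ^ i) \<le> 1 / 4"
      unfolding eventually_at_left_field
      using first_returns_partial_sum_le[OF loop] \<zeta>0 unfolding \<zeta>_def by blast
  qed simp
  show less: "\<zeta> < \<rho>"
  proof (rule ccontr)
    assume "\<not> \<zeta> < \<rho>"
    then have "\<rho>\<^sup>2 \<le> \<zeta>\<^sup>2" using rho_bounds by (intro power_mono) auto
    have "first_return_series (\<rho>\<^sup>2) \<le> 1 / 4"
      unfolding first_return_series_def
    proof (rule suminf_le_const[OF sm])
      fix n
      have "(\<Sum>i<n. real (first_returns i) * (\<rho>\<^sup>2) ^ i) \<le> (\<Sum>i\<le>n. real (first_returns i) * (\<zeta>\<^sup>2) ^ i)"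
        using power_mono[OF \<open>\<rho>\<^sup>2 \<le> \<zeta>\<^sup>2\<close>]
        by (intro order_trans[OF sum_mono sum_mono2] mult_left_mono) auto
      then show "(\<Sum>i<n. real (first_returns i) * (\<rho>\<^sup>2) ^ i) \<le> 1 / 4" using part[of n] by linarith
    qed
    then show False using big by simp
  qed
  have "summable (\<lambda>n. real (first_returns n) * (\<zeta>\<^sup>2) ^ n)"
    by (rule summable_power_le[OF _ sm]) (use less \<zeta>0 in \<open>auto intro: power_mono\<close>)
  then show "first_return_series (\<zeta>\<^sup>2) \<le> 1 / 4"
    unfolding first_return_series_def
  proof (rule suminf_le_const)
    fix n
    have "(\<Sum>i<n. real (first_returns i) * (\<zeta>\<^sup>2) ^ i) \<le> (\<Sum>i\<le>n. real (first_returns i) * (\<zeta>\<^sup>2) ^ i)"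
      by (intro sum_mono2) auto
    then show "(\<Sum>i<n. real (first_returns i) * (\<zeta>\<^sup>2) ^ i) \<le> 1 / 4" using part[of n] by linarith
  qed
qed

end

end

section \<open>The entropy bound\<close>

text \<open>The strict inequality \<open>1 - t < - ln t\<close>, at \<open>t = \<zeta>\<^sup>2 / \<rho>\<^sup>2\<close>.\<close>

lemma diff_squares_less_ln:
  fixes \<zeta> \<rho> :: real
  assumes "0 < \<zeta>" "\<zeta> < \<rho>"
  shows "(\<rho>\<^sup>2 - \<zeta>\<^sup>2) / (2 * \<rho>\<^sup>2) < ln \<rho> - ln \<zeta>"
proof -
  define t where "t = \<zeta>\<^sup>2 / \<rho>\<^sup>2"
  have "\<zeta>\<^sup>2 < \<rho>\<^sup>2" using assms by (intro power_strict_mono) auto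
  then have t: "0 < t" "t \<noteq> 1" using assms by (auto simp: t_def)
  then have "ln t < t - 1" using ln_le_minus_one[of t] ln_eq_minus_one[of t] by fastforce
  moreover have "ln t = 2 * ln \<zeta> - 2 * ln \<rho>"
    using assms by (simp add: t_def ln_div ln_realpow)
  moreover have "(\<rho>\<^sup>2 - \<zeta>\<^sup>2) / (2 * \<rho>\<^sup>2) = (1 - t) / 2"
    using assms by (simp add: t_def field_simps)
  moreover have "(1 - t) / 2 < ln \<rho> - ln \<zeta>"
    using \<open>ln t < t - 1\<close> \<open>ln t = _\<close> by (simp add: field_simps)
  ultimately show ?thesis by (simp only:)
qed

theorem theorem3p5:
  fixes G :: "('v, 'e) pre_digraph" and v :: 'v and r \<rho> :: real
  assumes "fin_digraph G"
    and "perron_eigenvalue (adjacency_mat G) r"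
    and "\<rho> = inverse r"
    and "v \<in> verts G"
    and "ratfun_eval (q_fract G v) (\<rho>\<^sup>2) < 3 / 4"
  shows "top_entropy (vertex_subshift G v) >
           - ln \<rho> + poly (p_del G v) \<rho> / (2 * \<rho>\<^sup>2 * poly (pderiv (p_poly G)) \<rho>)
                    * (ratfun_eval (q_fract G v) (\<rho>\<^sup>2) - 3 / 4)"
proof -
  interpret fin_digraph G by (rule assms(1))
  interpret pointed_fin_digraph G v by unfold_locales (rule assms(4))
  let ?F = "first_return_series" and ?p = "p_poly G" and ?pv = "p_del G v"
  have radius: "r = spectral_radius (adjacency_mat G)"
    and eigen: "eigenvalue (adjacency_mat G) (complex_of_real r)"
    using assms(2) by (auto simp: perron_eigenvalue_def)
  have r1: "1 \<le> r"
    using ratfun_eval_q_if_small_radius[of "\<rho>\<^sup>2"] assms(5) radius by force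
  note \<rho> = rho_bounds[OF radius r1 assms(3)]
  have q: "ratfun_eval (q_fract G v) (\<rho>\<^sup>2) = 1 - ?F (\<rho>\<^sup>2)"
    using ratfun_eval_q[OF radius r1 assms(3), of "\<rho>\<^sup>2"] \<rho> by simp
  then have big: "1 / 4 < ?F (\<rho>\<^sup>2)" using assms(5) by simp
  define \<zeta> where "\<zeta> = exp (- top_entropy (vertex_subshift G v))"
  have \<zeta>: "0 < \<zeta>" "\<zeta> < \<rho>" "?F (\<zeta>\<^sup>2) \<le> 1 / 4"
    using entropy_radius[OF radius r1 assms(3) big] by (auto simp: \<zeta>_def)
  have h: "top_entropy (vertex_subshift G v) = - ln \<zeta>" by (simp add: \<zeta>_def)
  have sq: "\<zeta>\<^sup>2 < \<rho>\<^sup>2" using \<zeta> by (intro power_strict_mono) auto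
  show ?thesis
  proof (cases "poly ?pv \<rho> = 0 \<or> poly (pderiv ?p) \<rho> = 0")
    case True
    \<comment> \<open>The correction term vanishes, in the second case because division by zero yields zero.\<close>
    then show ?thesis using \<zeta> by (auto simp: h)
  next
    case False
    \<comment> \<open>the derivative of \<open>F\<close> at \<open>\<rho>\<close> from the left\<close>
    define D where "D = - poly (pderiv ?p) \<rho> / poly ?pv \<rho>"
    have "poly ?p \<rho> = 0" using p_poly_root[OF eigen] r1 assms(3) by simp
    then have "((\<lambda>z. (?F \<rho> - ?F z) / (\<rho> - z)) \<longlongrightarrow> D) (at_left \<rho>)"
      unfolding D_def using False by (intro first_return_series_left_derivative[OF radius r1 assms(3)]) auto
    moreover have "\<forall>\<^sub>F z in at_left \<rho>. (?F (\<rho>\<^sup>2) - ?F (\<zeta>\<^sup>2)) / (\<rho>\<^sup>2 - \<zeta>\<^sup>2) \<le> (?F \<rho> - ?F z) / (\<rho> - z)"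
      unfolding eventually_at_left_field
    proof (intro exI[of _ "\<zeta>\<^sup>2"] conjI allI impI)
      show "\<zeta>\<^sup>2 < \<rho>" using sq \<rho>(3) by linarith
      show "(?F (\<rho>\<^sup>2) - ?F (\<zeta>\<^sup>2)) / (\<rho>\<^sup>2 - \<zeta>\<^sup>2) \<le> (?F \<rho> - ?F z) / (\<rho> - z)"
        if "\<zeta>\<^sup>2 < z" "z < \<rho>" for z
        unfolding first_return_series_def
        using that sq \<rho>(3) summable_first_returns_rho[OF radius r1 assms(3)]
        by (intro nonneg_power_series_slope_mono) auto
    qed
    ultimately have slope: "(?F (\<rho>\<^sup>2) - ?F (\<zeta>\<^sup>2)) / (\<rho>\<^sup>2 - \<zeta>\<^sup>2) \<le> D"
      by (rule tendsto_lowerbound) simp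
    have "0 < (?F (\<rho>\<^sup>2) - ?F (\<zeta>\<^sup>2)) / (\<rho>\<^sup>2 - \<zeta>\<^sup>2)" using big \<zeta> sq by simp
    then have "0 < D" using slope by linarith
    have "?F (\<rho>\<^sup>2) - 1 / 4 \<le> ?F (\<rho>\<^sup>2) - ?F (\<zeta>\<^sup>2)" using \<zeta> by simp
    also have "\<dots> \<le> D * (\<rho>\<^sup>2 - \<zeta>\<^sup>2)" using slope sq by (simp add: field_simps)
    finally have "(?F (\<rho>\<^sup>2) - 1 / 4) / (2 * \<rho>\<^sup>2 * D) \<le> D * (\<rho>\<^sup>2 - \<zeta>\<^sup>2) / (2 * \<rho>\<^sup>2 * D)"
      using \<open>0 < D\<close> by (intro divide_right_mono) auto
    also have "\<dots> = (\<rho>\<^sup>2 - \<zeta>\<^sup>2) / (2 * \<rho>\<^sup>2)" using \<open>0 < D\<close> by simp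
    also have "\<dots> < ln \<rho> - ln \<zeta>" by (rule diff_squares_less_ln[OF \<zeta>(1,2)])
    finally have "(?F (\<rho>\<^sup>2) - 1 / 4) / (2 * \<rho>\<^sup>2 * D) < ln \<rho> - ln \<zeta>" .
    moreover have "poly ?pv \<rho> / (2 * \<rho>\<^sup>2 * poly (pderiv ?p) \<rho>) = - 1 / (2 * \<rho>\<^sup>2 * D)"
      unfolding D_def using False by simp
    moreover have "- 1 / c * (1 - x - 3 / 4) = (x - 1 / 4) / c" for c x :: real
      by (cases "c = 0") (simp_all add: divide_simps)
    ultimately have "poly ?pv \<rho> / (2 * \<rho>\<^sup>2 * poly (pderiv ?p) \<rho>) * (ratfun_eval (q_fract G v) (\<rho>\<^sup>2) - 3 / 4)
        < ln \<rho> - ln \<zeta>"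
      by (simp only: q)
    then show ?thesis unfolding h by simp
  qed
qed

end
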